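(* Let $S$ be a finite subset of $]0,+\infty[$ of size $|S|\leqslant 3$ satisfying the $4$-values condition. Then the class $\mathcal{M}^{m<}_S$ has the ordering property: for every finite metric space $X$ with distances in $S$ there is a finite metric space $Y$ with distances in $S$ such that for every metric linear ordering $<^X$ on $X$ and every metric linear ordering $<^Y$ on $Y$, there is an order-preserving isometric embedding of $(X,<^X)$ into $(Y,<^Y)$.
   Context: $\mathcal{M}_S$ is the class of all finite metric spaces with distances in $S$ (all distances between distinct points belong to $S$). $S$ satisfies the $4$-values condition when for every $s_0,s_1,s_0',s_1'\in S$, if there is $t\in S$ with $|s_0-s_1|\leqslant t\leqslant s_0+s_1$ and $|s_0'-s_1'|\leqslant t\leqslant s_0'+s_1'$, then there is $u\in S$ with $|s_0-s_0'|\leqslant u\leqslant s_0+s_0'$ and $|s_1-s_1'|\leqslant u\leqslant s_1+s_1'$. For $s\in\,]0,+\infty[$ and $X\in\mathcal{M}_S$, let $\approx^X_s$ be the relation on $X$ defined by $x\approx^X_s y$ iff $d^X(x,y)\leqslant s$. Say that $s$ is critical for $\mathcal{M}_S$ when $\approx^X_s$ is an equivalence relation on $X$ for every $X\in\mathcal{M}_S$. A metric equivalence relation on $X\in\mathcal{M}_S$ is a relation of the form $\approx^X_s$ with $s$ critical for $\mathcal{M}_S$. A linear ordering $<$ on $X\in\mathcal{M}_S$ is metric when for every metric equivalence relation $\approx$ on $X$, all $\approx$-equivalence classes are $<$-convex. $\mathcal{M}^{m<}_S$ is the class of all pairs $(X,<^X)$ with $X\in\mathcal{M}_S$ and $<^X$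 a metric linear ordering on $X$. *)

theory Defs
  imports "HOL-Analysis.Analysis"
begin

definition four_values :: "real set \<Rightarrow> bool" where
  "four_values S \<longleftrightarrow>
     (\<forall>s0\<in>S. \<forall>s1\<in>S. \<forall>s0'\<in>S. \<forall>s1'\<in>S.
        (\<exists>t\<in>S. \<bar>s0 - s1\<bar> \<le> t \<and> t \<le> s0 + s1 \<and> \<bar>s0' - s1'\<bar> \<le> t \<and> t \<le> s0' + s1') \<longrightarrow>
        (\<exists>u\<in>S. \<bar>s0 - s0'\<bar> \<le> u \<and> u \<le> s0 + s0' \<and> \<bar>s1 - s1'\<bar> \<le> u \<and> u \<le> s1 + s1'))"

text \<open>The locale \<open>Metric_space\<close> asks for nonnegativity and symmetry of \<open>d\<close> on the whole type, not
  only on the carrier \<open>X\<close>. This is no restriction: a metric on \<open>X\<close> can be extended by \<open>0\<close>.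
  The empty space is included.\<close>

definition finite_metric_space :: "real set \<Rightarrow> 'a set \<Rightarrow> ('a \<Rightarrow> 'a \<Rightarrow> real) \<Rightarrow> bool" where
  "finite_metric_space S X d \<longleftrightarrow>
     finite X \<and> Metric_space X d \<and> (\<forall>x\<in>X. \<forall>y\<in>X. x \<noteq> y \<longrightarrow> d x y \<in> S)"

definition dist_rel :: "'a set \<Rightarrow> ('a \<Rightarrow> 'a \<Rightarrow> real) \<Rightarrow> real \<Rightarrow> 'a rel" where
  "dist_rel X d s = {(x, y). x \<in> X \<and> y \<in> X \<and> d x y \<le> s}"

text \<open>A definition cannot quantify over carrier types. Every finite metric space is isometric to
  one carried by a set of natural numbers, so quantifying over the latter covers all of them; see
  \<open>critical_imp_equiv\<close> below.\<close>

definition critical :: "real set \<Rightarrow> real \<Rightarrow> bool" where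
  "critical S s \<longleftrightarrow>
     0 < s \<and> (\<forall>(X :: nat set) d. finite_metric_space S X d \<longrightarrow> equiv X (dist_rel X d s))"

definition metric_equivalence ::
  "real set \<Rightarrow> 'a set \<Rightarrow> ('a \<Rightarrow> 'a \<Rightarrow> real) \<Rightarrow> 'a rel \<Rightarrow> bool" where
  "metric_equivalence S X d E \<longleftrightarrow> (\<exists>s. critical S s \<and> E = dist_rel X d s)"

definition order_convex :: "'a set \<Rightarrow> 'a rel \<Rightarrow> 'a set \<Rightarrow> bool" where
  "order_convex X r C \<longleftrightarrow>
     (\<forall>x\<in>C. \<forall>y\<in>C. \<forall>z\<in>X. (x, z) \<in> r \<and> (z, y) \<in> r \<longrightarrow> z \<in> C)"

text \<open>Linear orderings are strict. The constant \<open>strict_linear_order_on\<close> does not confine the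
  relation to \<open>X\<close>, hence the inclusion.\<close>

definition metric_linear_order ::
  "real set \<Rightarrow> 'a set \<Rightarrow> ('a \<Rightarrow> 'a \<Rightarrow> real) \<Rightarrow> 'a rel \<Rightarrow> bool" where
  "metric_linear_order S X d r \<longleftrightarrow>
     r \<subseteq> X \<times> X \<and> strict_linear_order_on X r \<and>
     (\<forall>E. metric_equivalence S X d E \<longrightarrow> (\<forall>C \<in> X // E. order_convex X r C))"

definition ordered_isometric_embedding ::
  "'a set \<Rightarrow> ('a \<Rightarrow> 'a \<Rightarrow> real) \<Rightarrow> 'a rel \<Rightarrow>
   'b set \<Rightarrow> ('b \<Rightarrow> 'b \<Rightarrow> real) \<Rightarrow> 'b rel \<Rightarrow> ('a \<Rightarrow> 'b) \<Rightarrow> bool" where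
  "ordered_isometric_embedding X dX rX Y dY rY f \<longleftrightarrow>
     f ` X \<subseteq> Y \<and>
     (\<forall>x\<in>X. \<forall>y\<in>X. dY (f x) (f y) = dX x y) \<and>
     (\<forall>x\<in>X. \<forall>y\<in>X. (x, y) \<in> rX \<longrightarrow> (f x, f y) \<in> rY)"

lemma critical_imp_equiv:
  fixes X :: "'a set"
  assumes crit: "critical S s" and X: "finite_metric_space S X d"
  shows "equiv X (dist_rel X d s)"
proof -
  interpret Metric_space X d
    using X by (simp add: finite_metric_space_def)
  have "finite X" using X by (simp add: finite_metric_space_def)
  then obtain f :: "'a \<Rightarrow> nat" where f: "inj_on f X"
    using finite_imp_inj_to_nat_seg by blast
  define g where "g = inv_into X f"
  have gf: "g (f x) = x" if "x \<in> X" for x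
    using f that by (simp add: g_def)
  define e where "e = (\<lambda>m n. d (g m) (g n))"
  have "Metric_space (f ` X) e"
    by unfold_locales (auto simp: e_def gf commute triangle)
  moreover have "\<forall>x\<in>f ` X. \<forall>y\<in>f ` X. x \<noteq> y \<longrightarrow> e x y \<in> S"
    using X by (auto simp: e_def gf finite_metric_space_def)
  ultimately have "finite_metric_space S (f ` X) e"
    using \<open>finite X\<close> by (simp add: finite_metric_space_def)
  then have "equiv (f ` X) (dist_rel (f ` X) e s)"
    using crit by (simp add: critical_def)
  then have tr: "trans (dist_rel (f ` X) e s)" by (simp add: equiv_def)
  have *: "(f x, f y) \<in> dist_rel (f ` X) e s \<longleftrightarrow> (x, y) \<in> dist_rel X d s"
    if "x \<in> X" "y \<in> X" for x y
    using that by (simp add: dist_rel_def e_def gf)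
  have sub: "dist_rel X d s \<subseteq> X \<times> X" by (auto simp: dist_rel_def)
  show ?thesis
  proof (rule equivI)
    show "refl_on X (dist_rel X d s)"
      using crit by (auto simp: refl_on_def dist_rel_def critical_def)
    show "sym (dist_rel X d s)" by (auto simp: sym_def dist_rel_def commute)
    show "trans (dist_rel X d s)"
    proof (rule transI)
      fix x y z assume xy: "(x, y) \<in> dist_rel X d s" and yz: "(y, z) \<in> dist_rel X d s"
      then have "x \<in> X" "y \<in> X" "z \<in> X" using sub by auto
      then show "(x, z) \<in> dist_rel X d s" using xy yz * tr by (meson transD)
    qed
  qed (rule sub)
qed

end

theory Submission
  imports Defs "HOL-Real_Asymp.Real_Asymp"
begin

text \<open>
  A finite metric space with distances in \<open>S\<close> is embedded, respecting all orders at once, by a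
  counting argument. Suppose that some \<open>b \<in> S\<close> forms a triangle with any two members of \<open>S\<close>. Take a hypergraph
  on \<open>n\<close> points whose edges have as many points as \<open>X\<close>, pairwise meet in at most one point and form no triangles,
  and put a copy of \<open>X\<close> on every edge, labelled at random. Give the distance \<open>b\<close> to all pairs that lie in
  no edge: by the sparseness of the hypergraph, every triangle either lies in one copy of \<open>X\<close> or has a side \<open>b\<close>,
  so this is a metric. For given orders on \<open>X\<close> and on the \<open>n\<close> points, each edge carries an order-preserving copy
  of \<open>X\<close> with a fixed positive probability, independently of the others. The number of orders is at most
  \<open>n ^ n\<close>, so if there are many more than \<open>n * ln n\<close> edges, a union bound yields a labelling that works for
  all orders (\<open>ex_order_universal_copy_system\<close>). Lines whose slopes lie on a parabola give such a hypergraph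
  (\<open>ex_sparse_hypergraph\<close>).

  The same argument works when the points of the hypergraph are replaced by columns of equidistant
  points, provided that the orders keep the columns convex. This covers those \<open>S\<close> whose smallest distance
  defines an equivalence relation between whose classes all larger distances are free.

  In the remaining cases a threshold \<open>t \<in> S\<close> splits \<open>S\<close> so that the distance between two points in different
  classes modulo \<open>t\<close> depends on the classes only. Then a witness for the ordering property is the
  lexicographic product of witnesses for the distances above and up to \<open>t\<close>
  (\<open>has_ordering_witness_lexicographic\<close>). For at most three distances with the \<open>4\<close>-values condition, an
  inspection of the possible sets shows that one of these three constructions always applies
  (\<open>has_ordering_witness_card_le_3\<close>).
\<close>

section \<open>Strict linear orders on finite sets\<close>

definition order_rank :: "'a rel \<Rightarrow> 'a set \<Rightarrow> 'a \<Rightarrow> nat" where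
  "order_rank r A x = card {y \<in> A. (y, x) \<in> r}"

lemma strict_linear_order_on_subset:
  "strict_linear_order_on X r \<Longrightarrow> A \<subseteq> X \<Longrightarrow> strict_linear_order_on A r"
  by (auto simp: strict_linear_order_on_def total_on_def)

lemma strict_linear_order_onD:
  assumes "strict_linear_order_on X r"
  shows "(x, x) \<notin> r" and "(x, y) \<in> r \<Longrightarrow> (y, z) \<in> r \<Longrightarrow> (x, z) \<in> r"
    and "x \<in> X \<Longrightarrow> y \<in> X \<Longrightarrow> x \<noteq> y \<Longrightarrow> (x, y) \<in> r \<or> (y, x) \<in> r"
  using assms by (auto simp: strict_linear_order_on_def irrefl_def total_on_def dest: transD)

lemma strict_linear_order_on_pullback:
  assumes "strict_linear_order_on B r" "inj_on h A" "h ` A \<subseteq> B"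
  shows "strict_linear_order_on A {(x, y). x \<in> A \<and> y \<in> A \<and> (h x, h y) \<in> r}"
  unfolding strict_linear_order_on_def
proof (intro conjI)
  show "trans {(x, y). x \<in> A \<and> y \<in> A \<and> (h x, h y) \<in> r}"
    by (auto intro!: transI intro: strict_linear_order_onD(2)[OF assms(1)])
  show "irrefl {(x, y). x \<in> A \<and> y \<in> A \<and> (h x, h y) \<in> r}"
    by (auto simp: irrefl_def strict_linear_order_onD(1)[OF assms(1)])
  show "total_on A {(x, y). x \<in> A \<and> y \<in> A \<and> (h x, h y) \<in> r}"
    using assms(2,3) strict_linear_order_onD(3)[OF assms(1)]
    by (auto simp: total_on_def inj_on_def image_subset_iff) blast
qed

lemma order_rank_less_iff:
  assumes "finite A" "strict_linear_order_on A r" "x \<in> A" "y \<in> A"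
  shows "order_rank r A x < order_rank r A y \<longleftrightarrow> (x, y) \<in> r"
proof -
  note D = strict_linear_order_onD[OF assms(2)]
  have mono: "order_rank r A x < order_rank r A y" if "(x, y) \<in> r" "x \<in> A" for x y
    unfolding order_rank_def
  proof (rule psubset_card_mono)
    show "{z \<in> A. (z, x) \<in> r} \<subset> {z \<in> A. (z, y) \<in> r}"
      using that D(1) D(2) by blast
  qed (use assms(1) in auto)
  show ?thesis
    using mono[of x y] mono[of y x] D(3)[of x y] assms(3,4) by (cases "x = y") auto
qed

lemma bij_betw_order_rank:
  assumes "finite A" "strict_linear_order_on A r"
  shows "bij_betw (order_rank r A) A {..<card A}"
proof -
  note D = strict_linear_order_onD[OF assms(2)]
  have inj: "inj_on (order_rank r A) A"
    by (rule inj_onI) (metis order_rank_less_iff[OF assms] D(3) less_irrefl)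
  have "order_rank r A ` A \<subseteq> {..<card A}"
  proof (clarsimp simp: order_rank_def)
    fix x assume "x \<in> A"
    then show "card {y \<in> A. (y, x) \<in> r} < card A"
      by (intro psubset_card_mono assms(1)) (use D(1) in auto)
  qed
  then have "order_rank r A ` A = {..<card A}"
    by (intro card_subset_eq) (auto simp: card_image[OF inj])
  then show ?thesis using inj by (simp add: bij_betw_def)
qed

text \<open>A finite linear order is recovered from its rank function. The bound \<open>n ^ n\<close>, whose logarithm
  exceeds the number of points only by a logarithmic factor, is what makes the union bound below work.
  Counting all relations, with logarithm quadratic in \<open>n\<close>, would be too coarse.\<close>

lemma strict_linear_orders_card_le:
  assumes "finite A"
  shows "finite {r. r \<subseteq> A \<times> A \<and> strict_linear_order_on A r}" (is "finite ?R")
    and "card {r. r \<subseteq> A \<times> A \<and> strict_linear_order_on A r} \<le> card A ^ card A"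
proof -
  show "finite ?R"
    by (rule finite_subset[of _ "Pow (A \<times> A)"]) (use assms in auto)
  define h where "h = (\<lambda>r. restrict (order_rank r A) A)"
  have "inj_on h ?R"
  proof (rule inj_onI)
    fix r r' assume r: "r \<in> ?R" and r': "r' \<in> ?R" and eq: "h r = h r'"
    have "order_rank r A x = order_rank r' A x" if "x \<in> A" for x
      using fun_cong[OF eq, of x] that by (simp add: h_def)
    then have "(x, y) \<in> r \<longleftrightarrow> (x, y) \<in> r'" if "x \<in> A" "y \<in> A" for x y
      using order_rank_less_iff[OF assms, of r x y] order_rank_less_iff[OF assms, of r' x y] r r' that
      by simp
    then show "r = r'" using r r' by auto
  qed
  moreover have "h ` ?R \<subseteq> A \<rightarrow>\<^sub>E {..<card A}"
  proof (rule image_subsetI)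
    fix r assume "r \<in> ?R"
    then have "order_rank r A x < card A" if "x \<in> A" for x
      using bij_betwE[OF bij_betw_order_rank[OF assms, of r]] that by auto
    then show "h r \<in> A \<rightarrow>\<^sub>E {..<card A}" by (simp add: h_def)
  qed
  ultimately have "card ?R \<le> card (A \<rightarrow>\<^sub>E {..<card A})"
    using assms by (intro card_inj_on_le[of h]) (auto intro: finite_PiE)
  then show "card ?R \<le> card A ^ card A"
    using assms by (simp add: card_PiE)
qed

lemma order_preserving_imp_inj_on:
  assumes "strict_linear_order_on A r" "irrefl s"
    and "\<And>x y. x \<in> A \<Longrightarrow> y \<in> A \<Longrightarrow> (x, y) \<in> r \<Longrightarrow> (f x, f y) \<in> s"
  shows "inj_on f A"
proof (rule inj_onI, rule ccontr)
  fix x y assume "x \<in> A" "y \<in> A" "f x = f y" "x \<noteq> y"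
  then show False
    using strict_linear_order_onD(3)[OF assms(1), of x y] assms(3)[of x y] assms(3)[of y x] assms(2)
    by (auto simp: irrefl_def)
qed

lemma ex_order_embedding:
  assumes "finite A" "strict_linear_order_on A r" "finite B" "strict_linear_order_on B s"
    and "card A \<le> card B"
  obtains f where "f ` A \<subseteq> B" "\<And>x y. x \<in> A \<Longrightarrow> y \<in> A \<Longrightarrow> (x, y) \<in> r \<Longrightarrow> (f x, f y) \<in> s"
proof -
  define f where "f = (\<lambda>x. inv_into B (order_rank s B) (order_rank r A x))"
  have A: "order_rank r A x < card B" if "x \<in> A" for x
    using bij_betwE[OF bij_betw_order_rank[OF assms(1,2)]] that assms(5) by force
  have img: "order_rank s B ` B = {..<card B}"
    using bij_betw_order_rank[OF assms(3,4)] by (simp add: bij_betw_def)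
  have fB: "f x \<in> B" and rank: "order_rank s B (f x) = order_rank r A x" if "x \<in> A" for x
    using A[OF that] img unfolding f_def by (auto intro: inv_into_into f_inv_into_f)
  have "(f x, f y) \<in> s" if "x \<in> A" "y \<in> A" "(x, y) \<in> r" for x y
    using that order_rank_less_iff[OF assms(1,2)] order_rank_less_iff[OF assms(3,4)] fB rank
    by metis
  then show ?thesis using fB by (intro that[of f]) auto
qed

section \<open>Orders with convex classes\<close>

text \<open>Equivalence relations are represented by functions \<open>\<kappa>\<close> whose fibres are the classes. Columns of a
  product (with \<open>\<kappa> = fst\<close>) and classes of nearby points (with \<open>\<kappa>\<close> choosing a representative) are
  then handled in the same way.\<close>

definition class_convex :: "'a set \<Rightarrow> 'a rel \<Rightarrow> ('a \<Rightarrow> 'c) \<Rightarrow> bool" where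
  "class_convex X r \<kappa> \<longleftrightarrow>
     (\<forall>x\<in>X. \<forall>y\<in>X. \<forall>z\<in>X. (x, z) \<in> r \<longrightarrow> (z, y) \<in> r \<longrightarrow> \<kappa> x = \<kappa> y \<longrightarrow> \<kappa> z = \<kappa> x)"

text \<open>Moving \<open>x\<close> inside its class past \<open>y\<close> would put \<open>y\<close> between two members of that class, and likewise
  for \<open>y\<close>. Hence an order with convex classes compares whole classes, which makes \<open>quotient_order\<close> a
  linear order.\<close>

lemma class_convex_less:
  assumes "strict_linear_order_on X r" "class_convex X r \<kappa>"
    and "x \<in> X" "y \<in> X" "x' \<in> X" "y' \<in> X"
    and "\<kappa> x \<noteq> \<kappa> y" "\<kappa> x' = \<kappa> x" "\<kappa> y' = \<kappa> y" "(x, y) \<in> r"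
  shows "(x', y') \<in> r"
proof -
  note D = strict_linear_order_onD[OF assms(1)]
  note C = assms(2)[unfolded class_convex_def, rule_format]
  have "x' \<noteq> y" "x' \<noteq> y'" using assms by auto
  have "(x', y) \<in> r"
    using C[of x x' y] D(3)[of x' y] assms \<open>x' \<noteq> y\<close> by auto
  then show ?thesis
    using C[of y' y x'] D(3)[of x' y'] assms \<open>x' \<noteq> y'\<close> by auto
qed

definition quotient_order :: "'a set \<Rightarrow> 'a rel \<Rightarrow> ('a \<Rightarrow> 'c) \<Rightarrow> 'c rel" where
  "quotient_order X r \<kappa> = {(\<kappa> x, \<kappa> y) | x y. x \<in> X \<and> y \<in> X \<and> (x, y) \<in> r \<and> \<kappa> x \<noteq> \<kappa> y}"

lemma quotient_order_iff:
  assumes "strict_linear_order_on X r" "class_convex X r \<kappa>" "x \<in> X" "y \<in> X"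
  shows "(\<kappa> x, \<kappa> y) \<in> quotient_order X r \<kappa> \<longleftrightarrow> (x, y) \<in> r \<and> \<kappa> x \<noteq> \<kappa> y"
proof
  assume "(\<kappa> x, \<kappa> y) \<in> quotient_order X r \<kappa>"
  then obtain x' y' where "\<kappa> x = \<kappa> x'" "\<kappa> y = \<kappa> y'" "x' \<in> X" "y' \<in> X" "(x', y') \<in> r" "\<kappa> x' \<noteq> \<kappa> y'"
    by (auto simp: quotient_order_def)
  then show "(x, y) \<in> r \<and> \<kappa> x \<noteq> \<kappa> y"
    using class_convex_less[OF assms(1,2), of x' y' x y] assms(3,4) by auto
qed (use assms in \<open>auto simp: quotient_order_def\<close>)

lemma strict_linear_order_on_quotient_order:
  assumes "strict_linear_order_on X r" "class_convex X r \<kappa>"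
  shows "strict_linear_order_on (\<kappa> ` X) (quotient_order X r \<kappa>)"
  unfolding strict_linear_order_on_def
proof (intro conjI)
  note D = strict_linear_order_onD[OF assms(1)]
  note Q = quotient_order_iff[OF assms]
  have sub: "quotient_order X r \<kappa> \<subseteq> \<kappa> ` X \<times> \<kappa> ` X" by (auto simp: quotient_order_def)
  show "trans (quotient_order X r \<kappa>)"
  proof (rule transI)
    fix a b c assume ab: "(a, b) \<in> quotient_order X r \<kappa>" and bc: "(b, c) \<in> quotient_order X r \<kappa>"
    then obtain x y z where xyz: "x \<in> X" "y \<in> X" "z \<in> X" "a = \<kappa> x" "b = \<kappa> y" "c = \<kappa> z"
      using sub by blast
    then have xy: "(x, y) \<in> r" "\<kappa> x \<noteq> \<kappa> y" "(y, z) \<in> r" using ab bc Q by auto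
    then have "\<kappa> x \<noteq> \<kappa> z"
      using assms(2) xyz unfolding class_convex_def by metis
    then show "(a, c) \<in> quotient_order X r \<kappa>" using xy xyz Q D(2) by blast
  qed
  show "irrefl (quotient_order X r \<kappa>)" by (auto simp: irrefl_def quotient_order_def)
  show "total_on (\<kappa> ` X) (quotient_order X r \<kappa>)"
    by (auto simp: total_on_def Q dest: D(3))
qed

text \<open>By convexity, an order is determined by its quotient and its restrictions to the classes. So a map is
  order preserving as soon as it is so on the quotient and inside each class.\<close>

lemma order_preserving_by_classes:
  assumes X: "strict_linear_order_on X r" "class_convex X r \<kappa>"
    and Y: "strict_linear_order_on Y s" "class_convex Y s \<pi>"
    and f: "f ` X \<subseteq> Y" "\<And>x. x \<in> X \<Longrightarrow> \<pi> (f x) = g (\<kappa> x)"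
    and across: "\<And>a b. a \<in> \<kappa> ` X \<Longrightarrow> b \<in> \<kappa> ` X \<Longrightarrow> (a, b) \<in> quotient_order X r \<kappa> \<Longrightarrow>
      (g a, g b) \<in> quotient_order Y s \<pi>"
    and within: "\<And>x y. x \<in> X \<Longrightarrow> y \<in> X \<Longrightarrow> \<kappa> x = \<kappa> y \<Longrightarrow> (x, y) \<in> r \<Longrightarrow> (f x, f y) \<in> s"
    and xy: "x \<in> X" "y \<in> X" "(x, y) \<in> r"
  shows "(f x, f y) \<in> s"
proof (cases "\<kappa> x = \<kappa> y")
  case False
  then have "(\<kappa> x, \<kappa> y) \<in> quotient_order X r \<kappa>"
    using quotient_order_iff[OF X] xy by auto
  then have "(\<pi> (f x), \<pi> (f y)) \<in> quotient_order Y s \<pi>"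
    using across f(2) xy by auto
  then show ?thesis using quotient_order_iff[OF Y] f(1) xy by blast
qed (use within xy in auto)

text \<open>The classes are sent to columns in increasing order, and every class goes increasingly into its column;
  there is room for both. The maps provided here are the labels among which the random choice below has to
  hit the right one.\<close>

lemma ex_classwise_embedding:
  assumes "finite X" and X: "strict_linear_order_on X r" "class_convex X r \<kappa>"
    and k: "card (\<kappa> ` X) \<le> k" and m: "\<And>x. x \<in> X \<Longrightarrow> card {y \<in> X. \<kappa> y = \<kappa> x} \<le> m"
    and Y: "strict_linear_order_on ({..<k} \<times> {..<m}) s" "class_convex ({..<k} \<times> {..<m}) s fst"
  shows "\<exists>f \<in> X \<rightarrow>\<^sub>E {..<k} \<times> {..<m}. inj_on f X \<and>
     (\<forall>x\<in>X. \<forall>y\<in>X. fst (f x) = fst (f y) \<longleftrightarrow> \<kappa> x = \<kappa> y) \<and>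
     (\<forall>x\<in>X. \<forall>y\<in>X. (x, y) \<in> r \<longrightarrow> (f x, f y) \<in> s)"
proof (cases "X = {}")
  case False
  have "0 < m"
  proof -
    obtain x where x: "x \<in> X" using False by auto
    then have "card {x} \<le> card {y \<in> X. \<kappa> y = \<kappa> x}" using assms(1) by (intro card_mono) auto
    then show ?thesis using m[OF x] by simp
  qed
  then have cols: "fst ` ({..<k} \<times> {..<m}) = {..<k}" by force
  have linQ: "strict_linear_order_on {..<k} (quotient_order ({..<k} \<times> {..<m}) s fst)"
    using strict_linear_order_on_quotient_order[OF Y] unfolding cols .
  have "finite (\<kappa> ` X)" "card (\<kappa> ` X) \<le> card {..<k}" using assms(1) k by simp_all
  then obtain g where g: "g ` (\<kappa> ` X) \<subseteq> {..<k}" and g2: "\<And>a b. a \<in> \<kappa> ` X \<Longrightarrow> b \<in> \<kappa> ` X \<Longrightarrow>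
      (a, b) \<in> quotient_order X r \<kappa> \<Longrightarrow> (g a, g b) \<in> quotient_order ({..<k} \<times> {..<m}) s fst"
    using ex_order_embedding[OF _ strict_linear_order_on_quotient_order[OF X] finite_lessThan linQ]
    by metis
  have g_inj: "inj_on g (\<kappa> ` X)"
    using g2 linQ by (intro order_preserving_imp_inj_on[OF strict_linear_order_on_quotient_order[OF X]])
      (auto simp: strict_linear_order_on_def)
  define fib where "fib = (\<lambda>c h. h ` {y \<in> X. \<kappa> y = c} \<subseteq> {..<m} \<and>
      (\<forall>x\<in>X. \<forall>y\<in>X. \<kappa> x = c \<longrightarrow> \<kappa> y = c \<longrightarrow> (x, y) \<in> r \<longrightarrow> ((g c, h x), (g c, h y)) \<in> s))"
  have "\<exists>h. fib c h" if c: "c \<in> \<kappa> ` X" for c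
  proof -
    let ?C = "{y \<in> X. \<kappa> y = c}"
    let ?s = "{(i, j). i \<in> {..<m} \<and> j \<in> {..<m} \<and> ((g c, i), (g c, j)) \<in> s}"
    have s: "strict_linear_order_on {..<m} ?s"
      by (rule strict_linear_order_on_pullback[OF Y(1)]) (use g c in \<open>auto simp: inj_on_def\<close>)
    have r: "strict_linear_order_on ?C r"
      by (rule strict_linear_order_on_subset[OF X(1)]) auto
    have C: "finite ?C" "card ?C \<le> card {..<m}" using assms(1) m c by auto
    obtain h where "h ` ?C \<subseteq> {..<m}" "\<And>x y. x \<in> ?C \<Longrightarrow> y \<in> ?C \<Longrightarrow> (x, y) \<in> r \<Longrightarrow> (h x, h y) \<in> ?s"
      by (rule ex_order_embedding[OF C(1) r finite_lessThan s C(2)]) blast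
    then have "fib c h" by (auto simp: fib_def)
    then show ?thesis by blast
  qed
  then obtain h where h: "\<And>c. c \<in> \<kappa> ` X \<Longrightarrow> fib c (h c)" by metis
  define f where "f = (\<lambda>x\<in>X. (g (\<kappa> x), h (\<kappa> x) x))"
  have f: "f \<in> X \<rightarrow>\<^sub>E {..<k} \<times> {..<m}" using g h by (fastforce simp: f_def fib_def)
  have ord: "(f x, f y) \<in> s" if "x \<in> X" "y \<in> X" "(x, y) \<in> r" for x y
  proof (rule order_preserving_by_classes[OF X Y _ _ g2 _ that])
    show "f ` X \<subseteq> {..<k} \<times> {..<m}" using PiE_mem[OF f] by blast
  qed (use h in \<open>auto simp: f_def fib_def\<close>)
  moreover have "inj_on f X"
    using ord Y(1) by (intro order_preserving_imp_inj_on[OF X(1)]) (auto simp: strict_linear_order_on_def)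
  moreover have "fst (f x) = fst (f y) \<longleftrightarrow> \<kappa> x = \<kappa> y" if "x \<in> X" "y \<in> X" for x y
    using that g_inj by (auto simp: f_def inj_on_def)
  ultimately show ?thesis using f by blast
qed auto

section \<open>The union bound\<close>

text \<open>If every entry of \<open>\<phi>\<close> is chosen uniformly and independently, a given requirement \<open>\<omega>\<close> is missed at all
  places with probability at most \<open>(1 - 1 / card \<Lambda>) ^ card I\<close>. The hypothesis \<open>few\<close> says that these
  probabilities have total below \<open>1\<close>. The proof is this union bound, carried out by counting.\<close>

lemma ex_choice_meeting_all_requirements:
  fixes Good :: "'w \<Rightarrow> 'i \<Rightarrow> 'l \<Rightarrow> bool"
  assumes "finite \<Omega>" "finite I" "finite \<Lambda>"
    and good: "\<And>\<omega> i. \<omega> \<in> \<Omega> \<Longrightarrow> i \<in> I \<Longrightarrow> \<exists>l\<in>\<Lambda>. Good \<omega> i l"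
    and few: "card \<Omega> * (card \<Lambda> - 1) ^ card I < card \<Lambda> ^ card I"
  shows "\<exists>\<phi>\<in>I \<rightarrow>\<^sub>E \<Lambda>. \<forall>\<omega>\<in>\<Omega>. \<exists>i\<in>I. Good \<omega> i (\<phi> i)"
proof (rule ccontr)
  assume neg: "\<not> ?thesis"
  obtain l where l: "\<And>\<omega> i. \<omega> \<in> \<Omega> \<Longrightarrow> i \<in> I \<Longrightarrow> l \<omega> i \<in> \<Lambda> \<and> Good \<omega> i (l \<omega> i)"
    using good by metis
  define B where "B = (\<lambda>\<omega>. \<Pi>\<^sub>E i\<in>I. \<Lambda> - {l \<omega> i})"
  have cardB: "card (B \<omega>) = (card \<Lambda> - 1) ^ card I" if "\<omega> \<in> \<Omega>" for \<omega>
    using l[OF that] assms(2,3) by (simp add: B_def card_PiE)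
  have "I \<rightarrow>\<^sub>E \<Lambda> \<subseteq> (\<Union>\<omega>\<in>\<Omega>. B \<omega>)"
  proof
    fix \<phi> assume phi: "\<phi> \<in> I \<rightarrow>\<^sub>E \<Lambda>"
    then obtain \<omega> where "\<omega> \<in> \<Omega>" "\<And>i. i \<in> I \<Longrightarrow> \<not> Good \<omega> i (\<phi> i)" using neg by blast
    then have "\<phi> i \<noteq> l \<omega> i" if "i \<in> I" for i using l that by metis
    then have "\<phi> \<in> B \<omega>" using phi by (auto simp: B_def PiE_iff)
    then show "\<phi> \<in> (\<Union>\<omega>\<in>\<Omega>. B \<omega>)" using \<open>\<omega> \<in> \<Omega>\<close> by blast
  qed
  moreover have "finite (\<Union>\<omega>\<in>\<Omega>. B \<omega>)"
    using assms(1-3) by (auto simp: B_def intro: finite_PiE)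
  ultimately have "card (I \<rightarrow>\<^sub>E \<Lambda>) \<le> card (\<Union>\<omega>\<in>\<Omega>. B \<omega>)" by (rule card_mono[rotated])
  also have "\<dots> \<le> (\<Sum>\<omega>\<in>\<Omega>. card (B \<omega>))" by (rule card_UN_le[OF assms(1)])
  also have "\<dots> = card \<Omega> * (card \<Lambda> - 1) ^ card I" using cardB by simp
  finally show False using few assms(2) by (simp add: card_PiE)
qed

section \<open>A sparse hypergraph with many edges\<close>

text \<open>Edges are lines in three-space, parametrised by the first coordinate \<open>i\<close>: the edge \<open>(x, u, v)\<close> starts
  at \<open>(0, u, v)\<close> and has slope \<open>(x, x\<^sup>2)\<close>. Taking all slopes on a parabola excludes triangles.\<close>

definition curve_edge :: "nat \<times> nat \<times> nat \<Rightarrow> nat \<Rightarrow> nat \<times> nat \<times> nat" where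
  "curve_edge = (\<lambda>(x, u, v) i. (i, u + i * x, v + i * x\<^sup>2))"

lemma curve_edge_column: "curve_edge \<alpha> i = curve_edge \<beta> j \<Longrightarrow> i = j"
  by (auto simp: curve_edge_def split: prod.splits)

lemma curve_edges_linear:
  assumes "curve_edge \<alpha> i = curve_edge \<beta> i" "curve_edge \<alpha> j = curve_edge \<beta> j" "i \<noteq> j"
  shows "\<alpha> = \<beta>"
proof -
  obtain x u v where \<alpha>: "\<alpha> = (x, u, v)" by (cases \<alpha>)
  obtain x' u' v' where \<beta>: "\<beta> = (x', u', v')" by (cases \<beta>)
  have i: "int u + int i * int x = int u' + int i * int x'"
    and j: "int u + int j * int x = int u' + int j * int x'"
    using assms(1,2) unfolding \<alpha> \<beta> curve_edge_def by (simp_all flip: of_nat_mult of_nat_add)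
  have "(int i - int j) * (int x - int x') = 0" using i j by (simp add: algebra_simps)
  then have "x = x'" using assms(3) by simp
  then show ?thesis using assms(1) \<alpha> \<beta> by (simp add: curve_edge_def)
qed

text \<open>In a triangle formed by three lines, the slope of one is a proper affine combination of the slopes
  of the other two. A parabola has no three distinct collinear points, so the slopes agree.\<close>

lemma curve_edges_triangle_free:
  assumes ac: "curve_edge \<alpha> i = curve_edge \<gamma> i" and ab: "curve_edge \<alpha> j = curve_edge \<beta> j"
    and bc: "curve_edge \<beta> l = curve_edge \<gamma> l"
    and distinct: "i \<noteq> j" "j \<noteq> l" "i \<noteq> l"
  shows "\<alpha> = \<beta>"
proof -
  obtain x u v where \<alpha>: "\<alpha> = (x, u, v)" by (cases \<alpha>)
  obtain x' u' v' where \<beta>: "\<beta> = (x', u', v')" by (cases \<beta>)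
  obtain x'' u'' v'' where \<gamma>: "\<gamma> = (x'', u'', v'')" by (cases \<gamma>)
  define p q where "p = int j - int i" and "q = int l - int j"
  have u: "int u + int i * int x = int u'' + int i * int x''"
     "int u + int j * int x = int u' + int j * int x'"
     "int u' + int l * int x' = int u'' + int l * int x''"
    using ab bc ac unfolding \<alpha> \<beta> \<gamma> curve_edge_def by (simp_all flip: of_nat_mult of_nat_add)
  have v: "int v + int i * (int x)\<^sup>2 = int v'' + int i * (int x'')\<^sup>2"
     "int v + int j * (int x)\<^sup>2 = int v' + int j * (int x')\<^sup>2"
     "int v' + int l * (int x')\<^sup>2 = int v'' + int l * (int x'')\<^sup>2"
    using ab bc ac unfolding \<alpha> \<beta> \<gamma> curve_edge_def
    by (simp_all flip: of_nat_mult of_nat_add of_nat_power)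
  \<comment> \<open>Eliminating the starting points expresses the collinearity of the three slopes.\<close>
  have "p * int x + q * int x' = (p + q) * int x''"
    using u unfolding p_def q_def by (simp add: algebra_simps)
  moreover have "p * (int x)\<^sup>2 + q * (int x')\<^sup>2 = (p + q) * (int x'')\<^sup>2"
    using v unfolding p_def q_def by (simp add: algebra_simps)
  ultimately have "p * q * (int x - int x')\<^sup>2 = 0" by algebra
  moreover have "p \<noteq> 0" "q \<noteq> 0" using distinct by (auto simp: p_def q_def)
  ultimately have "x = x'" by simp
  then show ?thesis using ab \<alpha> \<beta> by (simp add: curve_edge_def)
qed

text \<open>With slopes \<open>x < M\<close> and starting points in a box of size \<open>M \<times> M\<^sup>2\<close> there are \<open>M ^ 4\<close> edges, while
  for fixed \<open>k\<close> the points of their first \<open>k\<close> columns lie in a set of order \<open>M ^ 3\<close>. For large \<open>M\<close> the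
  number of edges beats the logarithm of the number of orders, which is of order \<open>M ^ 3 * ln M\<close>.\<close>

lemma ex_sparse_hypergraph:
  fixes k m K c :: nat
  assumes "0 < k" "0 < m" "0 < K" "0 < c"
  shows "\<exists>V I. finite V \<and> finite I \<and> (\<forall>\<alpha>\<in>I. \<forall>i<k. curve_edge \<alpha> i \<in> V) \<and>
    c * (card V * m) ^ (card V * m) * (K - 1) ^ card I < K ^ card I"
proof -
  define C where "C = k * (k + 1)\<^sup>2 * m"
  have "0 < C" using assms by (simp add: C_def)
  have ex: "\<exists>M>0. c * (C * M ^ 3) ^ (C * M ^ 3) * (K - 1) ^ (M ^ 4) < K ^ (M ^ 4)"
  proof (cases "K = 1")
    case False
    then have "1 < K" using assms by simp
    define \<delta> where "\<delta> = ln (real K) - ln (real (K - 1))"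
    have "0 < \<delta>" using \<open>1 < K\<close> by (simp add: \<delta>_def)
    have "eventually (\<lambda>M::nat. ln (real c) + real C * real M ^ 3 * ln (real C * real M ^ 3) < \<delta> * real M ^ 4) at_top"
      using \<open>0 < \<delta>\<close> \<open>0 < C\<close> by real_asymp
    then have "eventually (\<lambda>M::nat. 0 < M \<and>
        ln (real c) + real C * real M ^ 3 * ln (real C * real M ^ 3) < \<delta> * real M ^ 4) at_top"
      using eventually_gt_at_top[of "0::nat"] by eventually_elim auto
    then obtain M :: nat where M: "0 < M"
      "ln (real c) + real C * real M ^ 3 * ln (real C * real M ^ 3) < \<delta> * real M ^ 4"
      using eventually_happens'[OF sequentially_bot] by blast
    let ?l = "real (c * (C * M ^ 3) ^ (C * M ^ 3) * (K - 1) ^ (M ^ 4))"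
    have pos: "0 < ?l" "0 < real (K ^ (M ^ 4))" using M(1) \<open>0 < C\<close> \<open>1 < K\<close> assms by simp_all
    have "ln ?l = ln (real c) + real C * real M ^ 3 * ln (real C * real M ^ 3)
        + real M ^ 4 * ln (real (K - 1))"
      using M(1) \<open>0 < C\<close> \<open>1 < K\<close> assms by (simp add: ln_mult ln_realpow del: of_nat_diff)
    moreover have "\<dots> < ln (real (K ^ (M ^ 4)))"
      using M(2) \<open>1 < K\<close> by (simp add: ln_realpow \<delta>_def algebra_simps)
    ultimately have "ln ?l < ln (real (K ^ (M ^ 4)))" by linarith
    then have "?l < real (K ^ (M ^ 4))" using ln_less_cancel_iff[OF pos] by blast
    then show ?thesis using M(1) by (metis of_nat_less_iff)
  qed (rule exI[of _ 1], simp)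
  then obtain M where M: "0 < M" "c * (C * M ^ 3) ^ (C * M ^ 3) * (K - 1) ^ (M ^ 4) < K ^ (M ^ 4)"
    by blast
  define V where "V = {..<k} \<times> {..<(k + 1) * M} \<times> {..<(k + 1) * M\<^sup>2}"
  define I where "I = {..<M} \<times> {..<M} \<times> {..<M\<^sup>2}"
  have "card V * m = C * M ^ 3" "card I = M ^ 4"
    by (simp_all add: V_def I_def C_def card_cartesian_product eval_nat_numeral algebra_simps)
  moreover have "curve_edge \<alpha> i \<in> V" if "\<alpha> \<in> I" "i < k" for \<alpha> i
  proof -
    obtain x u v where \<alpha>: "\<alpha> = (x, u, v)" by (cases \<alpha>)
    have "u + i * x < (k + 1) * M" "v + i * x\<^sup>2 < (k + 1) * M\<^sup>2"
    proof -
      have "x < M" "u < M" "v < M\<^sup>2" using that(1) by (auto simp: I_def \<alpha>)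
      moreover have "i * x \<le> k * M" "i * x\<^sup>2 \<le> k * M\<^sup>2"
        using that(2) \<open>x < M\<close> by (auto intro!: mult_le_mono power_mono)
      ultimately show "u + i * x < (k + 1) * M" "v + i * x\<^sup>2 < (k + 1) * M\<^sup>2" by simp_all
    qed
    then show ?thesis using that(2) by (simp add: V_def curve_edge_def \<alpha>)
  qed
  ultimately show ?thesis
    using M(2) by (intro exI[of _ V] exI[of _ I]) (auto simp: V_def I_def)
qed

section \<open>Gluing copies that share few points\<close>

text \<open>Each \<open>F \<in> \<F>\<close> places a copy of \<open>X\<close> in a set of pairs (column, height), one column for each class. Two
  copies that share points of two different columns are equal (\<open>linear\<close>), and so are copies that
  meet pairwise in three different columns (\<open>triangle_free\<close>).\<close>

locale copy_system =
  fixes X :: "'a set" and \<kappa> :: "'a \<Rightarrow> 'c" and \<F> :: "('a \<Rightarrow> 'v \<times> 'j) set"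
  assumes inj: "F \<in> \<F> \<Longrightarrow> inj_on F X"
    and columns: "F \<in> \<F> \<Longrightarrow> x \<in> X \<Longrightarrow> y \<in> X \<Longrightarrow> fst (F x) = fst (F y) \<longleftrightarrow> \<kappa> x = \<kappa> y"
    and linear: "F \<in> \<F> \<Longrightarrow> G \<in> \<F> \<Longrightarrow> x \<in> X \<Longrightarrow> y \<in> X \<Longrightarrow> x' \<in> X \<Longrightarrow> y' \<in> X \<Longrightarrow>
      F x = G x' \<Longrightarrow> F y = G y' \<Longrightarrow> \<kappa> x \<noteq> \<kappa> y \<Longrightarrow> F = G"
    and triangle_free: "F \<in> \<F> \<Longrightarrow> G \<in> \<F> \<Longrightarrow> H \<in> \<F> \<Longrightarrow>
      x \<in> X \<Longrightarrow> y \<in> X \<Longrightarrow> y' \<in> X \<Longrightarrow> z' \<in> X \<Longrightarrow> x'' \<in> X \<Longrightarrow> z'' \<in> X \<Longrightarrow>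
      F x = H x'' \<Longrightarrow> F y = G y' \<Longrightarrow> G z' = H z'' \<Longrightarrow>
      \<kappa> x \<noteq> \<kappa> y \<Longrightarrow> \<kappa> y' \<noteq> \<kappa> z' \<Longrightarrow> \<kappa> x'' \<noteq> \<kappa> z'' \<Longrightarrow> F = G"
begin

definition covered :: "'v \<times> 'j \<Rightarrow> 'v \<times> 'j \<Rightarrow> bool" where
  "covered w w' \<longleftrightarrow> (\<exists>F\<in>\<F>. \<exists>x\<in>X. \<exists>y\<in>X. F x = w \<and> F y = w')"

text \<open>Distances inside copies are those of \<open>X\<close>, distances within a column are \<open>a\<close>, and every other pair
  gets the same distance \<open>b\<close>. The description is unambiguous because a pair of points in different columns
  lies in at most one copy.\<close>

definition glued_dist :: "real \<Rightarrow> real \<Rightarrow> ('a \<Rightarrow> 'a \<Rightarrow> real) \<Rightarrow> 'v \<times> 'j \<Rightarrow> 'v \<times> 'j \<Rightarrow> real" where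
  "glued_dist a b d w w' =
     (if w = w' then 0 else if fst w = fst w' then a
      else if covered w w' then THE \<delta>. \<exists>F\<in>\<F>. \<exists>x\<in>X. \<exists>y\<in>X. F x = w \<and> F y = w' \<and> d x y = \<delta>
      else b)"

lemma glued_dist_across:
  assumes F: "F \<in> \<F>" and xy: "x \<in> X" "y \<in> X" "\<kappa> x \<noteq> \<kappa> y"
  shows "glued_dist a b d (F x) (F y) = d x y"
proof -
  have "(THE \<delta>. \<exists>G\<in>\<F>. \<exists>x'\<in>X. \<exists>y'\<in>X. G x' = F x \<and> G y' = F y \<and> d x' y' = \<delta>) = d x y"
  proof (rule the_equality)
    fix \<delta> assume "\<exists>G\<in>\<F>. \<exists>x'\<in>X. \<exists>y'\<in>X. G x' = F x \<and> G y' = F y \<and> d x' y' = \<delta>"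
    then obtain G x' y' where G: "G \<in> \<F>" "x' \<in> X" "y' \<in> X" "G x' = F x" "G y' = F y" "d x' y' = \<delta>"
      by blast
    then have "F = G" using linear[OF F G(1) xy(1,2) G(2,3)] xy(3) by simp
    then have "x' = x" "y' = y" using G inj[OF F] xy by (auto dest: inj_onD)
    then show "\<delta> = d x y" using G by simp
  qed (use F xy in blast)
  moreover have "fst (F x) \<noteq> fst (F y)" using columns[OF F] xy by simp
  moreover have "covered (F x) (F y)" using F xy by (auto simp: covered_def)
  ultimately show ?thesis by (auto simp: glued_dist_def)
qed

lemma glued_dist_copy:
  assumes F: "F \<in> \<F>" and "x \<in> X" "y \<in> X" and "\<And>x. x \<in> X \<Longrightarrow> d x x = 0"
    and "\<And>x y. x \<in> X \<Longrightarrow> y \<in> X \<Longrightarrow> x \<noteq> y \<Longrightarrow> \<kappa> x = \<kappa> y \<Longrightarrow> d x y = a"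
  shows "glued_dist a b d (F x) (F y) = d x y"
proof (cases "\<kappa> x = \<kappa> y \<and> x \<noteq> y")
  case True
  then have "F x \<noteq> F y" "fst (F x) = fst (F y)"
    using inj[OF F] columns[OF F] assms(2,3) by (auto dest: inj_onD)
  then show ?thesis using True assms(2,3,5) by (simp add: glued_dist_def)
next
  case False
  then show ?thesis
    using glued_dist_across[OF F assms(2,3)] assms(2,4) by (cases "x = y") (auto simp: glued_dist_def)
qed

lemma covered_commute: "covered w w' = covered w' w"
  by (auto simp: covered_def)

lemma coveredE:
  assumes "covered w w'" "fst w \<noteq> fst w'"
  obtains F x y where "F \<in> \<F>" "x \<in> X" "y \<in> X" "F x = w" "F y = w'" "\<kappa> x \<noteq> \<kappa> y"
proof -
  obtain F x y where F: "F \<in> \<F>" "x \<in> X" "y \<in> X" "F x = w" "F y = w'"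
    using assms(1) by (auto simp: covered_def)
  then have "\<kappa> x \<noteq> \<kappa> y" using columns[of F x y] assms(2) by simp
  then show ?thesis using F by (intro that[of F x y])
qed

lemma glued_dist_commute:
  assumes "\<And>x y. d x y = d y x"
  shows "glued_dist a b d w w' = glued_dist a b d w' w"
proof (cases "covered w w' \<and> fst w \<noteq> fst w'")
  case True
  then have *: "covered w w'" "fst w \<noteq> fst w'" by auto
  obtain F x y where F: "F \<in> \<F>" "x \<in> X" "y \<in> X" "F x = w" "F y = w'" "\<kappa> x \<noteq> \<kappa> y"
    using coveredE[OF *] by blast
  have "glued_dist a b d w' w = d y x"
    using glued_dist_across[OF F(1,3,2)] F by simp
  moreover have "glued_dist a b d w w' = d x y"
    using glued_dist_across[OF F(1,2,3)] F by simp
  ultimately show ?thesis using assms by simp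
qed (auto simp: glued_dist_def covered_commute)

lemma glued_dist_cases:
  assumes "\<And>x y. x \<in> X \<Longrightarrow> y \<in> X \<Longrightarrow> \<kappa> x \<noteq> \<kappa> y \<Longrightarrow> d x y \<in> U" "b \<in> U" "fst w \<noteq> fst w'"
  shows "glued_dist a b d w w' \<in> U" "\<not> covered w w' \<Longrightarrow> glued_dist a b d w w' = b"
proof -
  show nc: "glued_dist a b d w w' = b" if "\<not> covered w w'"
    using that assms(3) by (auto simp: glued_dist_def)
  show "glued_dist a b d w w' \<in> U"
  proof (cases "covered w w'")
    case True
    obtain F x y where F: "F \<in> \<F>" "x \<in> X" "y \<in> X" "F x = w" "F y = w'" "\<kappa> x \<noteq> \<kappa> y"
      using coveredE[OF True assms(3)] by blast
    then show ?thesis using assms(1) glued_dist_across[OF F(1-3)] by auto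
  qed (simp add: nc assms(2))
qed

text \<open>A triangle with corners in three columns either lies in one copy of \<open>X\<close>, or has an edge outside all
  copies, which has the length \<open>b\<close> compatible with any two lengths from \<open>U\<close>. A triangle with two corners in
  one column has sides \<open>a\<close>, \<open>s\<close>, \<open>t\<close> with \<open>s, t \<in> U\<close>.\<close>

lemma Metric_space_glued_dist:
  assumes X: "Metric_space X d"
    and U: "\<And>x y. x \<in> X \<Longrightarrow> y \<in> X \<Longrightarrow> \<kappa> x \<noteq> \<kappa> y \<Longrightarrow> d x y \<in> U" "U \<subseteq> {0<..}"
    and b: "b \<in> U" "\<And>s t. s \<in> U \<Longrightarrow> t \<in> U \<Longrightarrow> b \<le> s + t \<and> s \<le> b + t"
    and "0 \<le> a"
    and a: "\<And>w w' s t. w \<in> W \<Longrightarrow> w' \<in> W \<Longrightarrow> w \<noteq> w' \<Longrightarrow> fst w = fst w' \<Longrightarrow> s \<in> U \<Longrightarrow> t \<in> U \<Longrightarrow>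
      0 < a \<and> a \<le> s + t \<and> s \<le> t + a"
  shows "Metric_space W (glued_dist a b d)"
proof -
  interpret X: Metric_space X d by fact
  let ?D = "glued_dist a b d"
  have com: "?D w w' = ?D w' w" for w w'
    by (rule glued_dist_commute) (rule X.commute)
  have across: "?D w w' \<in> U" "\<not> covered w w' \<Longrightarrow> ?D w w' = b" if "fst w \<noteq> fst w'" for w w'
    using glued_dist_cases[of d U b w w' a] that U(1) b(1) by auto
  have same: "?D w w' = a" if "fst w = fst w'" "w \<noteq> w'" for w w'
    using that by (simp add: glued_dist_def)
  have nonneg: "0 \<le> ?D w w'" for w w'
  proof (cases "fst w = fst w'")
    case True
    then show ?thesis using \<open>0 \<le> a\<close> by (simp add: glued_dist_def)
  next
    case False
    then show ?thesis using across(1) U(2) by fastforce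
  qed
  show ?thesis
  proof
    show "0 \<le> ?D w w'" for w w' by (rule nonneg)
    show "?D w w' = ?D w' w" for w w' by (rule com)
    show "?D w w' = 0 \<longleftrightarrow> w = w'" if "w \<in> W" "w' \<in> W" for w w'
    proof
      assume D: "?D w w' = 0"
      show "w = w'"
      proof (rule ccontr)
        assume "w \<noteq> w'"
        then show False
          using D a[OF that, of b b] b(1) same[of w w'] across(1)[of w w'] U(2) by (cases "fst w = fst w'") auto
      qed
    qed (simp add: glued_dist_def)
    fix w1 w2 w3 assume W: "w1 \<in> W" "w2 \<in> W" "w3 \<in> W"
    show "?D w1 w3 \<le> ?D w1 w2 + ?D w2 w3"
    proof (cases "w1 = w2 \<or> w2 = w3 \<or> w1 = w3")
      case True
      moreover have "?D w w = 0" for w by (simp add: glued_dist_def)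
      ultimately show ?thesis using nonneg[of w1 w2] nonneg[of w2 w3] by (elim disjE) simp_all
    next
      case False
      consider (all_same) "fst w1 = fst w2" "fst w2 = fst w3"
        | (w12) "fst w1 = fst w2" "fst w2 \<noteq> fst w3" | (w23) "fst w2 = fst w3" "fst w1 \<noteq> fst w2"
        | (w13) "fst w1 = fst w3" "fst w1 \<noteq> fst w2"
        | (distinct) "fst w1 \<noteq> fst w2" "fst w2 \<noteq> fst w3" "fst w1 \<noteq> fst w3"
        by metis
      then show ?thesis
      proof cases
        case all_same
        then show ?thesis using same[of w1 w2] same[of w2 w3] same[of w1 w3] False \<open>0 \<le> a\<close> by simp
      next
        case w12
        then have "?D w1 w3 \<in> U" "?D w2 w3 \<in> U" using across(1)[of w1 w3] across(1)[of w2 w3] by simp_all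
        then show ?thesis
          using a[OF W(1,2) _ w12(1), of "?D w1 w3" "?D w2 w3"] same[OF w12(1)] False by simp
      next
        case w23
        then have "?D w1 w3 \<in> U" "?D w1 w2 \<in> U" using across(1)[of w1 w3] across(1)[of w1 w2] by simp_all
        then show ?thesis
          using a[OF W(2,3) _ w23(1), of "?D w1 w3" "?D w1 w2"] same[OF w23(1)] False by simp
      next
        case w13
        then have "?D w1 w2 \<in> U" "?D w2 w3 \<in> U" using across(1)[of w1 w2] across(1)[of w2 w3] by simp_all
        then show ?thesis
          using a[OF W(1,3) _ w13(1), of "?D w1 w2" "?D w2 w3"] same[OF w13(1)] False by simp
      next
        case distinct
        then have D: "?D w1 w2 \<in> U" "?D w2 w3 \<in> U" "?D w1 w3 \<in> U" using across(1) by blast+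
        show ?thesis
        proof (cases "covered w1 w2 \<and> covered w2 w3 \<and> covered w1 w3")
          case False
          then show ?thesis
            using across(2)[of w1 w2] across(2)[of w2 w3] across(2)[of w1 w3] distinct D
              b(2)[of "?D w1 w2" "?D w2 w3"] b(2)[of "?D w1 w3" "?D w2 w3"] b(2)[of "?D w1 w3" "?D w1 w2"]
            by auto
        next
          case True
          obtain F x y where F: "F \<in> \<F>" "x \<in> X" "y \<in> X" "F x = w1" "F y = w2"
              "\<kappa> x \<noteq> \<kappa> y"
            using coveredE[of w1 w2] True distinct by blast
          obtain G y' z' where G: "G \<in> \<F>" "y' \<in> X" "z' \<in> X" "G y' = w2" "G z' = w3"
              "\<kappa> y' \<noteq> \<kappa> z'"
            using coveredE[of w2 w3] True distinct by blast
          obtain H x'' z'' where H: "H \<in> \<F>" "x'' \<in> X" "z'' \<in> X" "H x'' = w1" "H z'' = w3"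
              "\<kappa> x'' \<noteq> \<kappa> z''"
            using coveredE[of w1 w3] True distinct by blast
          have "F = G"
            by (rule triangle_free[of F G H x y y' z' x'' z'']) (use F G H in simp_all)
          moreover have "F = H"
            by (rule triangle_free[of F H G y x x'' z'' y' z']) (use F G H in simp_all)
          ultimately have "F y' = F y" "F x'' = F x" "F z'' = F z'"
            using F(4,5) G(4,5) H(4,5) by simp_all
          then have "y' = y" "x'' = x" "z'' = z'"
            using F(2,3) G(2,3) H(2,3) by (simp_all add: inj_on_eq_iff[OF inj[OF F(1)]])
          then have "?D w1 w2 = d x y" "?D w2 w3 = d y z'" "?D w1 w3 = d x z'"
            using glued_dist_across[OF F(1-3,6)] glued_dist_across[OF G(1-3,6)]
              glued_dist_across[OF H(1-3,6)] F(4,5) G(4,5) H(4,5) by simp_all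
          then show ?thesis using X.triangle[OF F(2,3) G(3)] by simp
        qed
      qed
    qed
  qed
qed

end

section \<open>Copies that meet every order\<close>

lemma ex_classwise_injection:
  assumes "finite X" and k: "card (\<kappa> ` X) \<le> k" and m: "\<And>x. x \<in> X \<Longrightarrow> card {y \<in> X. \<kappa> y = \<kappa> x} \<le> m"
  shows "\<exists>f \<in> X \<rightarrow>\<^sub>E {..<k} \<times> {..<m}. inj_on f X \<and>
     (\<forall>x\<in>X. \<forall>y\<in>X. fst (f x) = fst (f y) \<longleftrightarrow> \<kappa> x = \<kappa> y)"
proof -
  obtain g where g: "g ` (\<kappa> ` X) \<subseteq> {..<k}" "inj_on g (\<kappa> ` X)"
    using card_le_inj[of "\<kappa> ` X" "{..<k}"] assms(1) k by auto
  have "\<exists>h. h ` {y \<in> X. \<kappa> y = c} \<subseteq> {..<m} \<and> inj_on h {y \<in> X. \<kappa> y = c}" if "c \<in> \<kappa> ` X" for c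
    by (rule card_le_inj) (use assms(1) m that in auto)
  then obtain h where h: "\<And>c. c \<in> \<kappa> ` X \<Longrightarrow>
      h c ` {y \<in> X. \<kappa> y = c} \<subseteq> {..<m} \<and> inj_on (h c) {y \<in> X. \<kappa> y = c}" by metis
  define f where "f = (\<lambda>x\<in>X. (g (\<kappa> x), h (\<kappa> x) x))"
  have "f \<in> X \<rightarrow>\<^sub>E {..<k} \<times> {..<m}" using g h by (fastforce simp: f_def)
  moreover have fst: "fst (f x) = fst (f y) \<longleftrightarrow> \<kappa> x = \<kappa> y" if "x \<in> X" "y \<in> X" for x y
    using that g(2) by (auto simp: f_def inj_on_def)
  moreover have "inj_on f X"
  proof (rule inj_onI)
    fix x y assume xy: "x \<in> X" "y \<in> X" "f x = f y"
    then have "\<kappa> x = \<kappa> y" using fst[of x y] by simp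
    then show "x = y" using xy h[of "\<kappa> x"] by (auto simp: f_def inj_on_def)
  qed
  ultimately show ?thesis by blast
qed

text \<open>Label the edges of the sparse hypergraph by classwise injections of \<open>X\<close>. For a fixed pair of orders
  every edge has a label that makes its copy of \<open>X\<close> order preserving, and the hypergraph has so many edges
  that some labelling succeeds, somewhere, for every pair of orders.\<close>

lemma ex_order_universal_copy_system:
  fixes X :: "'a set" and \<kappa> :: "'a \<Rightarrow> 'c"
  assumes "finite X" "X \<noteq> {}" and m: "\<And>x. x \<in> X \<Longrightarrow> card {y \<in> X. \<kappa> y = \<kappa> x} \<le> m"
  obtains V :: "(nat \<times> nat \<times> nat) set" and \<F> where
    "finite V" "copy_system X \<kappa> \<F>" "\<And>F. F \<in> \<F> \<Longrightarrow> F ` X \<subseteq> V \<times> {..<m}"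
    "\<And>r s. r \<subseteq> X \<times> X \<Longrightarrow> strict_linear_order_on X r \<Longrightarrow> class_convex X r \<kappa> \<Longrightarrow> s \<subseteq> (V \<times> {..<m}) \<times> (V \<times> {..<m}) \<Longrightarrow>
       strict_linear_order_on (V \<times> {..<m}) s \<Longrightarrow> class_convex (V \<times> {..<m}) s fst \<Longrightarrow>
       \<exists>F\<in>\<F>. \<forall>x\<in>X. \<forall>y\<in>X. (x, y) \<in> r \<longrightarrow> (F x, F y) \<in> s"
proof -
  define k where "k = card (\<kappa> ` X)"
  define \<Lambda> where "\<Lambda> = {f \<in> X \<rightarrow>\<^sub>E {..<k} \<times> {..<m}. inj_on f X \<and>
     (\<forall>x\<in>X. \<forall>y\<in>X. fst (f x) = fst (f y) \<longleftrightarrow> \<kappa> x = \<kappa> y)}"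
  have \<Lambda>D: "f ` X \<subseteq> {..<k} \<times> {..<m}" "inj_on f X"
    "\<And>x y. x \<in> X \<Longrightarrow> y \<in> X \<Longrightarrow> fst (f x) = fst (f y) \<longleftrightarrow> \<kappa> x = \<kappa> y" if "f \<in> \<Lambda>" for f
    using that by (auto simp: \<Lambda>_def PiE_iff image_subset_iff)
  have fin\<Lambda>: "finite \<Lambda>"
    unfolding \<Lambda>_def using assms(1) by (intro finite_subset[OF _ finite_PiE[of X "\<lambda>_. {..<k} \<times> {..<m}"]]) auto
  moreover have "\<Lambda> \<noteq> {}"
    using ex_classwise_injection[of X \<kappa> k m] assms(1) m by (auto simp: \<Lambda>_def k_def)
  ultimately have "0 < card \<Lambda>" by (simp add: card_gt_0_iff)
  moreover have "0 < k" using assms(1,2) by (simp add: k_def card_gt_0_iff)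
  moreover have "0 < m"
  proof -
    obtain f x where "f \<in> \<Lambda>" "x \<in> X" using \<open>\<Lambda> \<noteq> {}\<close> assms(2) by blast
    then show ?thesis using \<Lambda>D(1) by fastforce
  qed
  moreover have "0 < card X ^ card X" using assms(1,2) by (simp add: card_gt_0_iff)
  ultimately obtain V I where V: "finite V" and I: "finite I"
    and VI: "\<And>\<alpha> i. \<alpha> \<in> I \<Longrightarrow> i < k \<Longrightarrow> curve_edge \<alpha> i \<in> V"
    and few: "card X ^ card X * (card V * m) ^ (card V * m) * (card \<Lambda> - 1) ^ card I < card \<Lambda> ^ card I"
    using ex_sparse_hypergraph by metis
  define W where "W = V \<times> {..<m}"
  have W: "finite W" "card W = card V * m" using V by (auto simp: W_def)
  define E :: "nat \<times> nat \<times> nat \<Rightarrow> nat \<times> nat \<Rightarrow> (nat \<times> nat \<times> nat) \<times> nat"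
    where "E = (\<lambda>\<alpha> p. (curve_edge \<alpha> (fst p), snd p))"
  have E_inj: "E \<alpha> p = E \<beta> q \<Longrightarrow> p = q" for \<alpha> \<beta> p q
    by (cases p, cases q) (auto simp: E_def dest: curve_edge_column)
  have E_fst: "fst (E \<alpha> p) = fst (E \<alpha> q) \<longleftrightarrow> fst p = fst q" for \<alpha> p q
    by (auto simp: E_def dest: curve_edge_column)
  have E_W: "E \<alpha> ` ({..<k} \<times> {..<m}) \<subseteq> W" if "\<alpha> \<in> I" for \<alpha>
    using VI[OF that] by (auto simp: E_def W_def)
  define RX where "RX = {r. r \<subseteq> X \<times> X \<and> strict_linear_order_on X r}"
  define RY where "RY = {s. s \<subseteq> W \<times> W \<and> strict_linear_order_on W s}"
  \<comment> \<open>The requirements to be met are all admissible pairs of orders.\<close>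
  define \<Omega> where "\<Omega> = {\<omega> \<in> RX \<times> RY. class_convex X (fst \<omega>) \<kappa> \<and> class_convex W (snd \<omega>) fst}"
  define Good where "Good = (\<lambda>\<omega> \<alpha> f. \<forall>x\<in>X. \<forall>y\<in>X. (x, y) \<in> fst \<omega> \<longrightarrow> (E \<alpha> (f x), E \<alpha> (f y)) \<in> snd \<omega>)"
  have fin: "finite (RX \<times> RY)" and "card (RX \<times> RY) \<le> card X ^ card X * card W ^ card W"
    using strict_linear_orders_card_le[OF assms(1)] strict_linear_orders_card_le[OF W(1)]
    by (auto simp: RX_def RY_def card_cartesian_product intro: mult_le_mono)
  moreover have "\<Omega> \<subseteq> RX \<times> RY" by (auto simp: \<Omega>_def)
  ultimately have fin\<Omega>: "finite \<Omega>" and "card \<Omega> \<le> card X ^ card X * card W ^ card W"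
    by (auto intro: finite_subset dest: card_mono[OF fin])
  then have "card \<Omega> * (card \<Lambda> - 1) ^ card I
      \<le> card X ^ card X * card W ^ card W * (card \<Lambda> - 1) ^ card I" by (intro mult_le_mono1)
  then have few': "card \<Omega> * (card \<Lambda> - 1) ^ card I < card \<Lambda> ^ card I"
    using few unfolding W(2) by linarith
  \<comment> \<open>The order restricted to an edge, with its columns, is an order on the grid of labels.\<close>
  have good: "\<exists>f\<in>\<Lambda>. Good \<omega> \<alpha> f" if \<omega>: "\<omega> \<in> \<Omega>" and \<alpha>: "\<alpha> \<in> I" for \<omega> \<alpha>
  proof -
    let ?B = "{..<k} \<times> {..<m}"
    define s where "s = {(p, q). p \<in> ?B \<and> q \<in> ?B \<and> (E \<alpha> p, E \<alpha> q) \<in> snd \<omega>}"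
    have r: "strict_linear_order_on X (fst \<omega>)" "class_convex X (fst \<omega>) \<kappa>"
      and w: "strict_linear_order_on W (snd \<omega>)" "class_convex W (snd \<omega>) fst"
      using \<omega> by (auto simp: \<Omega>_def RX_def RY_def)
    have s1: "strict_linear_order_on ?B s"
      unfolding s_def by (rule strict_linear_order_on_pullback[OF w(1) _ E_W[OF \<alpha>]])
        (auto intro!: inj_onI dest: E_inj)
    have s2: "class_convex ?B s fst"
      unfolding class_convex_def
    proof (intro ballI impI)
      fix p q t assume B: "p \<in> ?B" "q \<in> ?B" "t \<in> ?B" and s: "(p, t) \<in> s" "(t, q) \<in> s" and eq: "fst p = fst q"
      have "E \<alpha> p \<in> W" "E \<alpha> q \<in> W" "E \<alpha> t \<in> W" using B E_W[OF \<alpha>] by blast+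
      moreover have "(E \<alpha> p, E \<alpha> t) \<in> snd \<omega>" "(E \<alpha> t, E \<alpha> q) \<in> snd \<omega>" using s by (auto simp: s_def)
      ultimately have "fst (E \<alpha> t) = fst (E \<alpha> p)"
        using w(2) eq E_fst[of \<alpha> p q] unfolding class_convex_def by blast
      then show "fst t = fst p" using E_fst by simp
    qed
    obtain f where "f \<in> \<Lambda>" "\<forall>x\<in>X. \<forall>y\<in>X. (x, y) \<in> fst \<omega> \<longrightarrow> (f x, f y) \<in> s"
      using ex_classwise_embedding[OF assms(1) r _ m s1 s2] unfolding \<Lambda>_def k_def by blast
    then show ?thesis by (auto simp: Good_def s_def)
  qed
  obtain \<phi> where \<phi>: "\<phi> \<in> I \<rightarrow>\<^sub>E \<Lambda>" and meets: "\<And>\<omega>. \<omega> \<in> \<Omega> \<Longrightarrow> \<exists>\<alpha>\<in>I. Good \<omega> \<alpha> (\<phi> \<alpha>)"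
    using ex_choice_meeting_all_requirements[of \<Omega> I \<Lambda> Good, OF fin\<Omega> I fin\<Lambda> good few'] by blast
  have \<phi>\<Lambda>: "\<phi> \<alpha> \<in> \<Lambda>" if "\<alpha> \<in> I" for \<alpha> using \<phi> that by auto
  define \<F> where "\<F> = (\<lambda>\<alpha> x. E \<alpha> (\<phi> \<alpha> x)) ` I"
  have "copy_system X \<kappa> \<F>"
  proof
    fix F assume "F \<in> \<F>"
    then obtain \<alpha> where \<alpha>: "\<alpha> \<in> I" "F = (\<lambda>x. E \<alpha> (\<phi> \<alpha> x))" by (auto simp: \<F>_def)
    note \<Lambda>\<alpha> = \<Lambda>D[OF \<phi>\<Lambda>[OF \<alpha>(1)]]
    show "inj_on F X"
      using \<Lambda>\<alpha>(2) by (auto simp: \<alpha>(2) inj_on_def dest: E_inj)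
    show "fst (F x) = fst (F y) \<longleftrightarrow> \<kappa> x = \<kappa> y" if "x \<in> X" "y \<in> X" for x y
      using \<Lambda>\<alpha>(3)[OF that] by (simp add: \<alpha>(2) E_fst)
    fix G assume "G \<in> \<F>"
    then obtain \<beta> where \<beta>: "\<beta> \<in> I" "G = (\<lambda>x. E \<beta> (\<phi> \<beta> x))" by (auto simp: \<F>_def)
    have E_eq: "curve_edge \<alpha> (fst (\<phi> \<alpha> x)) = curve_edge \<beta> (fst (\<phi> \<beta> y))" "fst (\<phi> \<alpha> x) = fst (\<phi> \<beta> y)"
      if "E \<alpha> (\<phi> \<alpha> x) = E \<beta> (\<phi> \<beta> y)" for \<alpha> \<beta> x y
      using that curve_edge_column[of \<alpha> "fst (\<phi> \<alpha> x)" \<beta> "fst (\<phi> \<beta> y)"] by (simp_all add: E_def)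
    show "F = G" if "x \<in> X" "y \<in> X" "x' \<in> X" "y' \<in> X" "F x = G x'" "F y = G y'" "\<kappa> x \<noteq> \<kappa> y" for x y x' y'
    proof -
      have "fst (\<phi> \<alpha> x) \<noteq> fst (\<phi> \<alpha> y)" using \<Lambda>\<alpha>(3) that by simp
      moreover have "curve_edge \<alpha> (fst (\<phi> \<alpha> x)) = curve_edge \<beta> (fst (\<phi> \<alpha> x))"
        using E_eq[of \<alpha> x \<beta> x'] that(5) unfolding \<alpha>(2) \<beta>(2) by simp
      moreover have "curve_edge \<alpha> (fst (\<phi> \<alpha> y)) = curve_edge \<beta> (fst (\<phi> \<alpha> y))"
        using E_eq[of \<alpha> y \<beta> y'] that(6) unfolding \<alpha>(2) \<beta>(2) by simp
      ultimately have "\<alpha> = \<beta>" using curve_edges_linear by blast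
      then show ?thesis by (simp add: \<alpha>(2) \<beta>(2))
    qed
    fix H assume "H \<in> \<F>"
    then obtain \<gamma> where \<gamma>: "\<gamma> \<in> I" "H = (\<lambda>x. E \<gamma> (\<phi> \<gamma> x))" by (auto simp: \<F>_def)
    show "F = G" if X: "x \<in> X" "y \<in> X" "y' \<in> X" "z' \<in> X" "x'' \<in> X" "z'' \<in> X"
      and eq: "F x = H x''" "F y = G y'" "G z' = H z''"
      and neq: "\<kappa> x \<noteq> \<kappa> y" "\<kappa> y' \<noteq> \<kappa> z'" "\<kappa> x'' \<noteq> \<kappa> z''" for x y y' z' x'' z''
    proof -
      have 1: "fst (\<phi> \<alpha> x) = fst (\<phi> \<gamma> x'')" "curve_edge \<alpha> (fst (\<phi> \<alpha> x)) = curve_edge \<gamma> (fst (\<phi> \<gamma> x''))"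
        using E_eq[of \<alpha> x \<gamma> x''] eq(1) unfolding \<alpha>(2) \<gamma>(2) by simp_all
      have 2: "fst (\<phi> \<alpha> y) = fst (\<phi> \<beta> y')" "curve_edge \<alpha> (fst (\<phi> \<alpha> y)) = curve_edge \<beta> (fst (\<phi> \<beta> y'))"
        using E_eq[of \<alpha> y \<beta> y'] eq(2) unfolding \<alpha>(2) \<beta>(2) by simp_all
      have 3: "fst (\<phi> \<beta> z') = fst (\<phi> \<gamma> z'')" "curve_edge \<beta> (fst (\<phi> \<beta> z')) = curve_edge \<gamma> (fst (\<phi> \<gamma> z''))"
        using E_eq[of \<beta> z' \<gamma> z''] eq(3) unfolding \<beta>(2) \<gamma>(2) by simp_all
      have "fst (\<phi> \<alpha> x) \<noteq> fst (\<phi> \<alpha> y)" "fst (\<phi> \<beta> y') \<noteq> fst (\<phi> \<beta> z')" "fst (\<phi> \<gamma> x'') \<noteq> fst (\<phi> \<gamma> z'')"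
        using \<Lambda>D(3)[OF \<phi>\<Lambda>] \<alpha>(1) \<beta>(1) \<gamma>(1) X neq by simp_all
      then have "\<alpha> = \<beta>"
        using 1 2 3 by (intro curve_edges_triangle_free[of \<alpha> "fst (\<phi> \<alpha> x)" \<gamma> "fst (\<phi> \<alpha> y)" \<beta> "fst (\<phi> \<beta> z')"]) simp_all
      then show ?thesis by (simp add: \<alpha>(2) \<beta>(2))
    qed
  qed
  moreover have "F ` X \<subseteq> V \<times> {..<m}" if F: "F \<in> \<F>" for F
  proof -
    obtain \<alpha> where \<alpha>: "\<alpha> \<in> I" "F = (\<lambda>x. E \<alpha> (\<phi> \<alpha> x))"
      using F unfolding \<F>_def by blast
    show ?thesis
    proof (rule image_subsetI)
      fix x assume "x \<in> X"
      then have "\<phi> \<alpha> x \<in> {..<k} \<times> {..<m}" using \<Lambda>D(1)[OF \<phi>\<Lambda>[OF \<alpha>(1)]] by blast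
      then show "F x \<in> V \<times> {..<m}" using E_W[OF \<alpha>(1)] by (auto simp: \<alpha>(2) W_def)
    qed
  qed
  moreover have "\<exists>F\<in>\<F>. \<forall>x\<in>X. \<forall>y\<in>X. (x, y) \<in> r \<longrightarrow> (F x, F y) \<in> s"
    if r: "r \<subseteq> X \<times> X" "strict_linear_order_on X r" "class_convex X r \<kappa>" and s: "s \<subseteq> (V \<times> {..<m}) \<times> (V \<times> {..<m})"
      "strict_linear_order_on (V \<times> {..<m}) s" "class_convex (V \<times> {..<m}) s fst" for r s
  proof -
    have "(r, s) \<in> \<Omega>" using r s by (simp add: \<Omega>_def RX_def RY_def W_def)
    then obtain \<alpha> where \<alpha>: "\<alpha> \<in> I" "Good (r, s) \<alpha> (\<phi> \<alpha>)" using meets by blast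
    then have "\<forall>x\<in>X. \<forall>y\<in>X. (x, y) \<in> r \<longrightarrow> (E \<alpha> (\<phi> \<alpha> x), E \<alpha> (\<phi> \<alpha> y)) \<in> s"
      by (auto simp: Good_def)
    moreover have "(\<lambda>x. E \<alpha> (\<phi> \<alpha> x)) \<in> \<F>" using \<alpha>(1) by (simp add: \<F>_def)
    ultimately show ?thesis by (rule bexI[of _ "\<lambda>x. E \<alpha> (\<phi> \<alpha> x)"])
  qed
  ultimately show ?thesis using V by (intro that[of V \<F>])
qed

section \<open>Gaps and metric orders\<close>

text \<open>No distance lies between \<open>t\<close> (exclusive) and \<open>2 * t\<close>, so by the triangle inequality two distances of
  at most \<open>t\<close> add up to a distance of at most \<open>t\<close>: such a \<open>t\<close> is critical. Convexity for these thresholds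
  is all that the constructions use of a metric order.\<close>

definition gap :: "real set \<Rightarrow> real \<Rightarrow> bool" where
  "gap S t \<longleftrightarrow> 0 < t \<and> (\<forall>s\<in>S. s \<le> 2 * t \<longrightarrow> s \<le> t)"

lemma finite_metric_spaceD:
  assumes "finite_metric_space S X d"
  shows "finite X" "Metric_space X d" "\<And>x y. x \<in> X \<Longrightarrow> y \<in> X \<Longrightarrow> x \<noteq> y \<Longrightarrow> d x y \<in> S"
  using assms by (auto simp: finite_metric_space_def)

lemma gap_trans:
  assumes X: "finite_metric_space S X d" and t: "gap S t"
    and "x \<in> X" "y \<in> X" "z \<in> X" "d x y \<le> t" "d y z \<le> t"
  shows "d x z \<le> t"
proof (cases "x = z")
  case True
  then show ?thesis
    using Metric_space.mdist_zero[OF finite_metric_spaceD(2)[OF X]] assms(3) t by (simp add: gap_def)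
next
  case False
  have "d x z \<le> d x y + d y z"
    using Metric_space.triangle[OF finite_metric_spaceD(2)[OF X]] assms by blast
  then show ?thesis
    using finite_metric_spaceD(3)[OF X _ _ False] assms by (force simp: gap_def)
qed

lemma gap_imp_critical:
  assumes "gap S t"
  shows "critical S t"
  unfolding critical_def
proof (intro conjI allI impI)
  show "0 < t" using assms by (simp add: gap_def)
  fix X :: "nat set" and d assume X: "finite_metric_space S X d"
  note M = finite_metric_spaceD(2)[OF X]
  show "equiv X (dist_rel X d t)"
  proof (rule equivI)
    show "dist_rel X d t \<subseteq> X \<times> X" by (auto simp: dist_rel_def)
    show "refl_on X (dist_rel X d t)"
      using \<open>0 < t\<close> by (auto simp: refl_on_def dist_rel_def Metric_space.mdist_zero[OF M])
    show "sym (dist_rel X d t)"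
      by (auto simp: sym_def dist_rel_def Metric_space.commute[OF M])
    show "trans (dist_rel X d t)"
      using gap_trans[OF X assms] by (auto simp: trans_def dist_rel_def)
  qed
qed

text \<open>The convexity of the classes of points at distance at most \<open>t\<close>, in terms of distances. Unlike
  \<open>metric_linear_order\<close>, it is easily transferred to subspaces and to other sets of distances, since
  only the set \<open>S\<close> enters and no other metric space.\<close>

definition gap_order :: "real set \<Rightarrow> 'a set \<Rightarrow> ('a \<Rightarrow> 'a \<Rightarrow> real) \<Rightarrow> 'a rel \<Rightarrow> bool" where
  "gap_order S X d r \<longleftrightarrow> r \<subseteq> X \<times> X \<and> strict_linear_order_on X r \<and>
     (\<forall>t x y z. gap S t \<longrightarrow> x \<in> X \<longrightarrow> y \<in> X \<longrightarrow> z \<in> X \<longrightarrow> (x, z) \<in> r \<longrightarrow> (z, y) \<in> r \<longrightarrow>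
        d x y \<le> t \<longrightarrow> d x z \<le> t)"

lemma gap_orderD:
  assumes "gap_order S X d r"
  shows "r \<subseteq> X \<times> X" "strict_linear_order_on X r"
    "\<And>t x y z. gap S t \<Longrightarrow> x \<in> X \<Longrightarrow> y \<in> X \<Longrightarrow> z \<in> X \<Longrightarrow> (x, z) \<in> r \<Longrightarrow> (z, y) \<in> r \<Longrightarrow>
        d x y \<le> t \<Longrightarrow> d x z \<le> t"
  using assms by (auto simp: gap_order_def)

lemma metric_linear_order_imp_gap_order:
  assumes S: "finite_metric_space S X d" and r: "metric_linear_order S X d r"
  shows "gap_order S X d r"
  unfolding gap_order_def
proof (intro conjI allI impI)
  show "r \<subseteq> X \<times> X" "strict_linear_order_on X r"
    using r by (auto simp: metric_linear_order_def)
  fix t x y z assume t: "gap S t" and X: "x \<in> X" "y \<in> X" "z \<in> X"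
    and xzy: "(x, z) \<in> r" "(z, y) \<in> r" and xy: "d x y \<le> t"
  have "metric_equivalence S X d (dist_rel X d t)"
    using gap_imp_critical[OF t] by (auto simp: metric_equivalence_def)
  moreover have "dist_rel X d t `` {x} \<in> X // dist_rel X d t" using X by (simp add: quotientI)
  ultimately have "order_convex X r (dist_rel X d t `` {x})"
    using r by (simp add: metric_linear_order_def)
  moreover have "y \<in> dist_rel X d t `` {x}" using X xy by (simp add: dist_rel_def)
  moreover have "x \<in> dist_rel X d t `` {x}"
    using X t Metric_space.mdist_zero[OF finite_metric_spaceD(2)[OF S]] by (simp add: dist_rel_def gap_def)
  ultimately have "z \<in> dist_rel X d t `` {x}"
    using X xzy unfolding order_convex_def by blast
  then show "d x z \<le> t" by (simp add: dist_rel_def)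
qed

section \<open>Witnesses for the ordering property\<close>

definition has_ordering_witness :: "real set \<Rightarrow> 'a set \<Rightarrow> ('a \<Rightarrow> 'a \<Rightarrow> real) \<Rightarrow> bool" where
  "has_ordering_witness S X d \<longleftrightarrow> (\<exists>(Y :: nat set) e. finite_metric_space S Y e \<and>
     (\<forall>r s. gap_order S X d r \<longrightarrow> gap_order S Y e s \<longrightarrow>
        (\<exists>f. ordered_isometric_embedding X d r Y e s f)))"

text \<open>A witness on any carrier can be moved to the natural numbers, since only its finiteness matters.\<close>

lemma has_ordering_witnessI:
  fixes Y :: "'b set"
  assumes Y: "finite_metric_space S Y e"
    and emb: "\<And>r s. gap_order S X d r \<Longrightarrow> gap_order S Y e s \<Longrightarrow>
      \<exists>f. ordered_isometric_embedding X d r Y e s f"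
  shows "has_ordering_witness S X d"
proof -
  interpret Y: Metric_space Y e using finite_metric_spaceD(2)[OF Y] .
  obtain h :: "'b \<Rightarrow> nat" where h: "inj_on h Y"
    using finite_imp_inj_to_nat_seg[OF finite_metric_spaceD(1)[OF Y]] by blast
  define g where "g = inv_into Y h"
  have gh: "g (h y) = y" if "y \<in> Y" for y using h that by (simp add: g_def)
  define e' where "e' = (\<lambda>m n. e (g m) (g n))"
  have "Metric_space (h ` Y) e'"
    by unfold_locales (auto simp: e'_def gh Y.commute Y.triangle)
  moreover have "e' m n \<in> S" if mn: "m \<in> h ` Y" "n \<in> h ` Y" "m \<noteq> n" for m n
  proof -
    obtain x y where "x \<in> Y" "y \<in> Y" "m = h x" "n = h y" using mn by blast
    then show ?thesis using finite_metric_spaceD(3)[OF Y, of x y] mn(3) by (auto simp: e'_def gh)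
  qed
  ultimately have "finite_metric_space S (h ` Y) e'"
    using finite_metric_spaceD(1)[OF Y] by (simp add: finite_metric_space_def)
  moreover have "\<exists>f. ordered_isometric_embedding X d r (h ` Y) e' s f"
    if r: "gap_order S X d r" and s: "gap_order S (h ` Y) e' s" for r s
  proof -
    note S = gap_orderD[OF s]
    let ?s = "{(x, y). x \<in> Y \<and> y \<in> Y \<and> (h x, h y) \<in> s}"
    have "gap_order S Y e ?s"
      unfolding gap_order_def
    proof (intro conjI allI impI)
      show "strict_linear_order_on Y ?s"
        by (rule strict_linear_order_on_pullback[OF S(2) h]) auto
      fix t x y z assume "gap S t" "x \<in> Y" "y \<in> Y" "z \<in> Y" "(x, z) \<in> ?s" "(z, y) \<in> ?s" "e x y \<le> t"
      then show "e x z \<le> t"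
        using S(3)[of t "h x" "h y" "h z"] by (simp add: e'_def gh)
    qed auto
    then obtain f where "ordered_isometric_embedding X d r Y e ?s f" using emb[OF r] by blast
    then have "ordered_isometric_embedding X d r (h ` Y) e' s (h \<circ> f)"
      unfolding ordered_isometric_embedding_def
      by (auto simp: e'_def gh image_subset_iff)
    then show ?thesis by blast
  qed
  ultimately show ?thesis unfolding has_ordering_witness_def by blast
qed

lemma has_ordering_witness_subsingleton:
  assumes "\<And>x y. x \<in> X \<Longrightarrow> y \<in> X \<Longrightarrow> x = y" "Metric_space X d"
  shows "has_ordering_witness S X d"
proof (rule has_ordering_witnessI)
  show "finite_metric_space S {0 :: nat} (\<lambda>_ _. 0)"
    by (auto simp: finite_metric_space_def Metric_space_def)
  fix r s assume r: "gap_order S X d r"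
  have "(x, y) \<notin> r" if "x \<in> X" "y \<in> X" for x y
    using assms(1)[OF that] strict_linear_order_onD(1)[OF gap_orderD(2)[OF r]] by simp
  moreover have "d x y = 0" if "x \<in> X" "y \<in> X" for x y
    using assms(1)[OF that] that Metric_space.mdist_zero[OF assms(2)] by simp
  ultimately show "\<exists>f. ordered_isometric_embedding X d r {0 :: nat} (\<lambda>_ _. 0) s f"
    by (auto simp: ordered_isometric_embedding_def)
qed

text \<open>The universal system of copies, made into a metric space by filling in distances. For \<open>m = 1\<close> the
  columns are single points. For larger \<open>m\<close> the columns are the classes of distance at
  most \<open>a\<close> of the witness, and are convex because \<open>a\<close> is a gap.\<close>

lemma has_ordering_witness_by_copies:
  fixes X :: "'a set" and \<kappa> :: "'a \<Rightarrow> 'c"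
  assumes X: "finite_metric_space S X d" "X \<noteq> {}" and S: "S \<subseteq> {0<..}"
    and m: "\<And>x. x \<in> X \<Longrightarrow> card {y \<in> X. \<kappa> y = \<kappa> x} \<le> m"
    and same: "\<And>x y. x \<in> X \<Longrightarrow> y \<in> X \<Longrightarrow> x \<noteq> y \<Longrightarrow> \<kappa> x = \<kappa> y \<Longrightarrow> d x y = a"
    and across: "\<And>x y. x \<in> X \<Longrightarrow> y \<in> X \<Longrightarrow> \<kappa> x \<noteq> \<kappa> y \<Longrightarrow> d x y \<in> U"
    and convex: "\<And>r. gap_order S X d r \<Longrightarrow> class_convex X r \<kappa>"
    and U: "U \<subseteq> S" and b: "b \<in> U" "\<And>s t. s \<in> U \<Longrightarrow> t \<in> U \<Longrightarrow> b \<le> s + t \<and> s \<le> b + t"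
    and "0 \<le> a"
    and a: "1 < m \<Longrightarrow> a \<in> S \<and> gap S a \<and> (\<forall>s\<in>U. a < s \<and> (\<forall>t\<in>U. s \<le> t + a))"
  shows "has_ordering_witness S X d"
proof -
  interpret X: Metric_space X d using finite_metric_spaceD(2)[OF X(1)] .
  obtain V :: "(nat \<times> nat \<times> nat) set" and \<F> where V: "finite V" and cs: "copy_system X \<kappa> \<F>"
    and img: "\<And>F. F \<in> \<F> \<Longrightarrow> F ` X \<subseteq> V \<times> {..<m}"
    and univ: "\<And>r s. r \<subseteq> X \<times> X \<Longrightarrow> strict_linear_order_on X r \<Longrightarrow> class_convex X r \<kappa> \<Longrightarrow>
       s \<subseteq> (V \<times> {..<m}) \<times> (V \<times> {..<m}) \<Longrightarrow>
       strict_linear_order_on (V \<times> {..<m}) s \<Longrightarrow> class_convex (V \<times> {..<m}) s fst \<Longrightarrow>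
       \<exists>F\<in>\<F>. \<forall>x\<in>X. \<forall>y\<in>X. (x, y) \<in> r \<longrightarrow> (F x, F y) \<in> s"
    using ex_order_universal_copy_system[OF finite_metric_spaceD(1)[OF X(1)] X(2) m] by blast
  interpret copy_system X \<kappa> \<F> by fact
  define Y where "Y = V \<times> {..<m}"
  define e where "e = glued_dist a b d"
  have m1: "1 < m" if "w \<in> Y" "w' \<in> Y" "w \<noteq> w'" "fst w = fst w'" for w w'
    using that by (cases w; cases w') (auto simp: Y_def)
  have e_across: "e w w' \<in> U" if "fst w \<noteq> fst w'" for w w'
    unfolding e_def by (rule glued_dist_cases(1)[OF across b(1) that])
  have e_same: "e w w' = (if w = w' then 0 else a)" if "fst w = fst w'" for w w'
    using that by (simp add: e_def glued_dist_def)
  have "Metric_space Y e"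
    unfolding e_def
  proof (rule Metric_space_glued_dist[OF X.Metric_space_axioms across _ b \<open>0 \<le> a\<close>])
    show "U \<subseteq> {0<..}" using U S by blast
    fix w w' s t assume w: "w \<in> Y" "w' \<in> Y" "w \<noteq> w'" "fst w = fst w'" and st: "s \<in> U" "t \<in> U"
    have "a \<in> S" "a < s" "a < t" "s \<le> t + a" using a[OF m1[OF w]] st by auto
    moreover have "0 < a" using S \<open>a \<in> S\<close> by auto
    ultimately show "0 < a \<and> a \<le> s + t \<and> s \<le> t + a" by simp
  qed
  moreover have "e w w' \<in> S" if "w \<in> Y" "w' \<in> Y" "w \<noteq> w'" for w w'
    using e_across[of w w'] e_same[of w w'] a m1[OF that] U that(3) by (cases "fst w = fst w'") auto
  ultimately have "finite_metric_space S Y e"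
    using V by (auto simp: finite_metric_space_def Y_def)
  moreover have "\<exists>f. ordered_isometric_embedding X d r Y e s f"
    if r: "gap_order S X d r" and s: "gap_order S Y e s" for r s
  proof -
    note s' = gap_orderD[OF s]
    have "class_convex Y s fst"
      unfolding class_convex_def
    proof (intro ballI impI)
      fix x y z assume Y: "x \<in> Y" "y \<in> Y" "z \<in> Y" and xzy: "(x, z) \<in> s" "(z, y) \<in> s" and xy: "fst x = fst y"
      have "x \<noteq> y" using strict_linear_order_onD(1,2)[OF s'(2)] xzy by blast
      then have a': "gap S a" "\<And>s. s \<in> U \<Longrightarrow> a < s" using a m1[OF Y(1,2)] xy by auto
      have "e x z \<le> a" using s'(3)[OF a'(1) Y xzy] e_same[OF xy] \<open>x \<noteq> y\<close> by simp
      then show "fst z = fst x" using e_across[of x z] a'(2)[of "e x z"] by fastforce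
    qed
    then obtain F where F: "F \<in> \<F>" "\<forall>x\<in>X. \<forall>y\<in>X. (x, y) \<in> r \<longrightarrow> (F x, F y) \<in> s"
      using univ[of r s] gap_orderD(1,2)[OF r] convex[OF r] s'(1,2) unfolding Y_def by blast
    have "e (F x) (F y) = d x y" if "x \<in> X" "y \<in> X" for x y
      unfolding e_def by (rule glued_dist_copy[OF F(1) that]) (use same in auto)
    then have "ordered_isometric_embedding X d r Y e s F"
      using F img[OF F(1)] by (auto simp: ordered_isometric_embedding_def Y_def)
    then show ?thesis by blast
  qed
  ultimately show ?thesis by (rule has_ordering_witnessI)
qed


text \<open>The length \<open>b\<close> is compatible with any two others, so it can be given to all pairs of points on which
  no copy of \<open>X\<close> has imposed a distance.\<close>

lemma has_ordering_witness_filler: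
  fixes X :: "'a set"
  assumes X: "finite_metric_space S X d" and S: "S \<subseteq> {0<..}"
    and b: "b \<in> S" "\<And>s t. s \<in> S \<Longrightarrow> t \<in> S \<Longrightarrow> b \<le> s + t \<and> s \<le> b + t"
  shows "has_ordering_witness S X d"
proof (cases "X = {}")
  case True
  then show ?thesis
    by (intro has_ordering_witness_subsingleton finite_metric_spaceD(2)[OF X]) simp_all
next
  case False
  show ?thesis
  proof (rule has_ordering_witness_by_copies[OF X False S, where \<kappa> = "\<lambda>x. x" and m = 1 and a = 0 and U = S and b = b])
    show "card {y \<in> X. y = x} \<le> 1" for x
      using card_mono[of "{x}" "{y \<in> X. y = x}"] by auto
    show "class_convex X r (\<lambda>x. x)" if "gap_order S X d r" for r
      unfolding class_convex_def
      using strict_linear_order_onD(1)[OF gap_orderD(2)[OF that]]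
        strict_linear_order_onD(2)[OF gap_orderD(2)[OF that]] by metis
  qed (use finite_metric_spaceD(3)[OF X] b in auto)
qed

text \<open>The classes of points at distance at most \<open>t\<close> as fibres of a function from \<open>X\<close> to \<open>X\<close>; its image is
  a copy of the quotient inside \<open>X\<close>.\<close>

lemma ex_representatives:
  assumes X: "finite_metric_space S X d" and t: "gap S t"
  obtains \<rho> where "\<And>x. x \<in> X \<Longrightarrow> \<rho> x \<in> X" "\<And>x. x \<in> X \<Longrightarrow> d x (\<rho> x) \<le> t"
    "\<And>x y. x \<in> X \<Longrightarrow> y \<in> X \<Longrightarrow> \<rho> x = \<rho> y \<longleftrightarrow> d x y \<le> t"
proof -
  interpret Metric_space X d using finite_metric_spaceD(2)[OF X] .
  define \<rho> where "\<rho> = (\<lambda>x. SOME y. y \<in> X \<and> d x y \<le> t)"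
  have \<rho>: "\<rho> x \<in> X \<and> d x (\<rho> x) \<le> t" if "x \<in> X" for x
    unfolding \<rho>_def by (rule someI[of _ x]) (use that t in \<open>simp add: gap_def\<close>)
  have eq: "\<rho> x = \<rho> y \<longleftrightarrow> d x y \<le> t" if xy: "x \<in> X" "y \<in> X" for x y
  proof
    assume "\<rho> x = \<rho> y"
    then show "d x y \<le> t" using gap_trans[OF X t, of x "\<rho> x" y] \<rho>[OF xy(1)] \<rho>[OF xy(2)] xy commute[of y "\<rho> y"]
      by simp
  next
    assume "d x y \<le> t"
    then have "z \<in> X \<and> d x z \<le> t \<longleftrightarrow> z \<in> X \<and> d y z \<le> t" for z
      using gap_trans[OF X t, of x y z] gap_trans[OF X t, of y x z] xy commute[of x y] by auto
    then show "\<rho> x = \<rho> y" by (simp add: \<rho>_def)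
  qed
  show ?thesis using \<rho> eq by (intro that[of \<rho>]) auto
qed

lemma gap_order_class_convex:
  assumes r: "gap_order S X d r" and t: "gap S t"
    and \<rho>: "\<And>x y. x \<in> X \<Longrightarrow> y \<in> X \<Longrightarrow> \<rho> x = \<rho> y \<longleftrightarrow> d x y \<le> t"
  shows "class_convex X r \<rho>"
  unfolding class_convex_def
proof (intro ballI impI)
  fix x y z assume "x \<in> X" "y \<in> X" "z \<in> X" "(x, z) \<in> r" "(z, y) \<in> r" "\<rho> x = \<rho> y"
  then have "\<rho> x = \<rho> z" using gap_orderD(3)[OF r t, of x y z] \<rho> by simp
  then show "\<rho> z = \<rho> x" by simp
qed

text \<open>The smallest distance \<open>a\<close> defines an equivalence relation, but imposes nothing on the distances
  between two classes, as any two larger distances differ by at most \<open>a\<close>. Hence the classes can be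
  treated as columns of equidistant points, with all cross distances free to be filled by \<open>b\<close>.\<close>

lemma has_ordering_witness_equidistant_classes:
  fixes X :: "'a set"
  assumes X: "finite_metric_space S X d" and S: "S \<subseteq> {0<..}"
    and a: "a \<in> S" "\<And>s. s \<in> S \<Longrightarrow> a \<le> s" "gap S a"
    and b: "b \<in> S" "a < b" "\<And>s t. s \<in> S \<Longrightarrow> t \<in> S \<Longrightarrow> a < s \<Longrightarrow> a < t \<Longrightarrow> b \<le> s + t \<and> s \<le> b + t"
    and near: "\<And>s t. s \<in> S \<Longrightarrow> t \<in> S \<Longrightarrow> a < t \<Longrightarrow> s \<le> t + a"
  shows "has_ordering_witness S X d"
proof (cases "X = {}")
  case True
  then show ?thesis
    by (intro has_ordering_witness_subsingleton finite_metric_spaceD(2)[OF X]) simp_all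
next
  case False
  obtain \<rho> where "\<And>x. x \<in> X \<Longrightarrow> \<rho> x \<in> X" "\<And>x. x \<in> X \<Longrightarrow> d x (\<rho> x) \<le> a"
    and \<rho>: "\<And>x y. x \<in> X \<Longrightarrow> y \<in> X \<Longrightarrow> \<rho> x = \<rho> y \<longleftrightarrow> d x y \<le> a"
    using ex_representatives[OF X a(3)] by blast
  show ?thesis
  proof (rule has_ordering_witness_by_copies[OF X False S, where \<kappa> = \<rho> and m = "card X" and a = a
        and U = "{s \<in> S. a < s}" and b = b])
    show "card {y \<in> X. \<rho> y = \<rho> x} \<le> card X" for x
      using finite_metric_spaceD(1)[OF X] by (intro card_mono) auto
    show "d x y = a" if "x \<in> X" "y \<in> X" "x \<noteq> y" "\<rho> x = \<rho> y" for x y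
      using \<rho>[OF that(1,2)] that(4) a(2)[OF finite_metric_spaceD(3)[OF X that(1-3)]] by simp
    show "d x y \<in> {s \<in> S. a < s}" if "x \<in> X" "y \<in> X" "\<rho> x \<noteq> \<rho> y" for x y
    proof -
      have "x \<noteq> y" using that(3) by blast
      then show ?thesis using \<rho>[OF that(1,2)] that finite_metric_spaceD(3)[OF X] by simp
    qed
    show "class_convex X r \<rho>" if "gap_order S X d r" for r
      by (rule gap_order_class_convex[OF that a(3) \<rho>])
    show "0 \<le> a" using a(1) S by auto
  qed (use a b near in auto)
qed

section \<open>Lexicographic products\<close>

text \<open>Distances above \<open>t\<close> are so far apart that they depend only on the classes modulo \<open>t\<close> of the two points.
  So \<open>X\<close> embeds in a lexicographic product of its quotient (all distances above \<open>t\<close>) with one space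
  containing all classes (all distances at most \<open>t\<close>). The lexicographic product of witnesses for the two
  factors is a witness: since \<open>t\<close> is a gap, every order considered on the product has convex columns.\<close>

lemma has_ordering_witness_lexicographic:
  fixes X :: "'a set"
  assumes X: "finite_metric_space S X d" and S: "S \<subseteq> {0<..}"
    and t: "t \<in> S" "gap S t" and sep: "\<And>s s'. s \<in> S \<Longrightarrow> s' \<in> S \<Longrightarrow> t < s \<Longrightarrow> s < s' \<Longrightarrow> s + t < s'"
    and lower: "\<And>e. finite_metric_space {s \<in> S. s \<le> t} X e \<Longrightarrow> has_ordering_witness {s \<in> S. s \<le> t} X e"
    and upper: "\<And>Q. Q \<subseteq> X \<Longrightarrow> finite_metric_space {s \<in> S. t < s} Q d \<Longrightarrow>
      has_ordering_witness {s \<in> S. t < s} Q d"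
  shows "has_ordering_witness S X d"
proof (cases "X = {}")
  case True
  then show ?thesis
    by (intro has_ordering_witness_subsingleton finite_metric_spaceD(2)[OF X]) simp_all
next
  case False
  interpret X: Metric_space X d using finite_metric_spaceD(2)[OF X] .
  let ?L = "{s \<in> S. s \<le> t}" and ?U = "{s \<in> S. t < s}"
  have "0 < t" using t(2) by (simp add: gap_def)
  have U: "2 * t < s" if "s \<in> ?U" for s using t(2) that by (force simp: gap_def)
  obtain \<rho> where \<rho>X: "\<And>x. x \<in> X \<Longrightarrow> \<rho> x \<in> X" and \<rho>d: "\<And>x. x \<in> X \<Longrightarrow> d x (\<rho> x) \<le> t"
    and \<rho>: "\<And>x y. x \<in> X \<Longrightarrow> y \<in> X \<Longrightarrow> \<rho> x = \<rho> y \<longleftrightarrow> d x y \<le> t"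
    by (rule ex_representatives[OF X t(2)]) blast
  have \<rho>\<rho>: "\<rho> (\<rho> x) = \<rho> x" if "x \<in> X" for x
    using \<rho>[OF that \<rho>X[OF that]] \<rho>d[OF that] by simp
  have dU: "d x y \<in> ?U" if "x \<in> X" "y \<in> X" "t < d x y" for x y
  proof -
    have "x \<noteq> y" using that \<open>0 < t\<close> by auto
    then show ?thesis using that finite_metric_spaceD(3)[OF X] by simp
  qed
  have swap: "d x z = d y z" if "x \<in> X" "y \<in> X" "z \<in> X" "d x y \<le> t" "t < d x z" for x y z
  proof -
    have "t < d y z" using gap_trans[OF X t(2), of x y z] that by force
    then have yz: "d y z \<in> ?U" and xz: "d x z \<in> ?U" using dU that by auto
    have "d x z \<le> d x y + d y z" "d y z \<le> d x y + d x z"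
      using X.triangle[of x y z] X.triangle[of y x z] X.commute[of x y] that by auto
    then show ?thesis using sep[of "d x z" "d y z"] sep[of "d y z" "d x z"] xz yz that(4) by force
  qed
  have d\<rho>: "d (\<rho> x) (\<rho> y) = d x y" if xy: "x \<in> X" "y \<in> X" "t < d x y" for x y
  proof -
    have "d (\<rho> x) y = d x y" using swap[of x "\<rho> x" y] \<rho>X \<rho>d xy by simp
    moreover have "d y (\<rho> x) = d (\<rho> y) (\<rho> x)"
      using swap[of y "\<rho> y" "\<rho> x"] \<rho>X \<rho>d xy calculation X.commute[of y "\<rho> x"] by simp
    ultimately show ?thesis using X.commute[of y "\<rho> x"] X.commute[of "\<rho> x" "\<rho> y"] by simp
  qed
  \<comment> \<open>Truncating the distances of \<open>X\<close> at \<open>t\<close> changes nothing inside a class. This one space contains all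
    classes at once, and every order considered on \<open>X\<close> is also admissible for it.\<close>
  define d0 where "d0 = (\<lambda>x y. min (d x y) t)"
  have d0: "finite_metric_space ?L X d0"
    unfolding finite_metric_space_def
  proof (intro conjI ballI impI)
    show "finite X" by (rule finite_metric_spaceD(1)[OF X])
    show "Metric_space X d0"
    proof
      fix x y z assume "x \<in> X" "y \<in> X" "z \<in> X"
      then show "d0 x z \<le> d0 x y + d0 y z"
        using X.triangle[of x y z] X.nonneg[of x y] X.nonneg[of y z] \<open>0 < t\<close>
        by (auto simp: d0_def min_def simp del: X.nonneg)
    qed (use \<open>0 < t\<close> in \<open>auto simp: d0_def X.commute min_def\<close>)
    show "d0 x y \<in> ?L" if "x \<in> X" "y \<in> X" "x \<noteq> y" for x y
      using finite_metric_spaceD(3)[OF X that] t(1) by (auto simp: d0_def min_def)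
  qed
  have Q: "finite_metric_space ?U (\<rho> ` X) d"
    unfolding finite_metric_space_def
  proof (intro conjI ballI impI)
    show "finite (\<rho> ` X)" using finite_metric_spaceD(1)[OF X] by simp
    show "Metric_space (\<rho> ` X) d" by (rule X.subspace) (use \<rho>X in auto)
    show "d p q \<in> ?U" if pq: "p \<in> \<rho> ` X" "q \<in> \<rho> ` X" "p \<noteq> q" for p q
    proof -
      have "p \<in> X" "q \<in> X" "\<rho> p = p" "\<rho> q = q" using pq \<rho>X \<rho>\<rho> by auto
      then show ?thesis using \<rho>[of p q] pq(3) dU[of p q] by simp
    qed
  qed
  obtain Y2 :: "nat set" and e2 where Y2: "finite_metric_space ?L Y2 e2"
    and emb2: "\<And>r s. gap_order ?L X d0 r \<Longrightarrow> gap_order ?L Y2 e2 s \<Longrightarrow>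
      \<exists>f. ordered_isometric_embedding X d0 r Y2 e2 s f"
    using lower[OF d0] unfolding has_ordering_witness_def by blast
  have "\<rho> ` X \<subseteq> X" using \<rho>X by blast
  then obtain Y1 :: "nat set" and e1 where Y1: "finite_metric_space ?U Y1 e1"
    and emb1: "\<And>r s. gap_order ?U (\<rho> ` X) d r \<Longrightarrow> gap_order ?U Y1 e1 s \<Longrightarrow>
      \<exists>f. ordered_isometric_embedding (\<rho> ` X) d r Y1 e1 s f"
    using upper[OF _ Q] unfolding has_ordering_witness_def by blast
  interpret Y1: Metric_space Y1 e1 using finite_metric_spaceD(2)[OF Y1] .
  interpret Y2: Metric_space Y2 e2 using finite_metric_spaceD(2)[OF Y2] .
  have e1U: "e1 u v \<in> ?U" if "u \<in> Y1" "v \<in> Y1" "u \<noteq> v" for u v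
    by (rule finite_metric_spaceD(3)[OF Y1 that])
  have e2t: "e2 i j \<le> t" if "i \<in> Y2" "j \<in> Y2" for i j
    using finite_metric_spaceD(3)[OF Y2 that] \<open>0 < t\<close> that by (cases "i = j") auto
  define Y where "Y = Y1 \<times> Y2"
  define e where "e = (\<lambda>(u, i) (v, j). if u = v then e2 i j else e1 u v)"
  have e_le: "e w w' \<le> t \<longleftrightarrow> fst w = fst w'" if "w \<in> Y" "w' \<in> Y" for w w'
    using that e2t[of "snd w" "snd w'"] e1U[of "fst w" "fst w'"]
    by (auto simp: e_def Y_def split: if_splits)
  have e: "finite_metric_space S Y e"
    unfolding finite_metric_space_def
  proof (intro conjI ballI impI)
    show "finite Y" using finite_metric_spaceD(1)[OF Y1] finite_metric_spaceD(1)[OF Y2] by (simp add: Y_def)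
    show "e w w' \<in> S" if "w \<in> Y" "w' \<in> Y" "w \<noteq> w'" for w w'
      using that e1U finite_metric_spaceD(3)[OF Y2] by (auto simp: e_def Y_def split: prod.splits)
    show "Metric_space Y e"
    proof
      show "0 \<le> e w w'" "e w w' = e w' w" for w w'
        by (auto simp: e_def Y1.commute Y2.commute split: prod.splits)
      show "e w w' = 0 \<longleftrightarrow> w = w'" if "w \<in> Y" "w' \<in> Y" for w w'
        using that by (auto simp: e_def Y_def split: prod.splits)
      fix w1 w2 w3 assume "w1 \<in> Y" "w2 \<in> Y" "w3 \<in> Y"
      then obtain u i v j x l where w: "w1 = (u, i)" "w2 = (v, j)" "w3 = (x, l)"
        and Y: "u \<in> Y1" "v \<in> Y1" "x \<in> Y1" "i \<in> Y2" "j \<in> Y2" "l \<in> Y2" by (auto simp: Y_def)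
      show "e w1 w3 \<le> e w1 w2 + e w2 w3"
      proof (cases "u = x")
        case True
        then show ?thesis
          using Y2.triangle[OF Y(4-6)] e2t[OF Y(4,6)] U[OF e1U[OF Y(1,2)]] U[OF e1U[OF Y(2,3)]] \<open>0 < t\<close>
          by (cases "u = v") (auto simp: w e_def)
      next
        case False
        then show ?thesis
          using Y1.triangle[OF Y(1-3)] Y2.nonneg[of i j] Y2.nonneg[of j l]
          by (cases "u = v"; cases "v = x") (auto simp: w e_def)
      qed
    qed
  qed
  moreover have "\<exists>f. ordered_isometric_embedding X d r Y e s f"
    if r: "gap_order S X d r" and s: "gap_order S Y e s" for r s
  proof -
    note r' = gap_orderD[OF r] and s' = gap_orderD[OF s]
    note rD = strict_linear_order_onD[OF r'(2)] and sD = strict_linear_order_onD[OF s'(2)]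
    \<comment> \<open>A gap of the distances above \<open>t\<close> is a gap of \<open>S\<close> once it reaches one of them; below that it
      demands nothing. A gap of the lower distances is a gap of \<open>S\<close> if it is below \<open>t\<close>, and demands nothing
      from \<open>t\<close> on.\<close>
    have gapU: "gap S c" if "gap ?U c" "u \<in> ?U" "u \<le> c" for c u
      using that by (auto simp: gap_def)
    have gapL: "gap S c" if "gap ?L c" "c < t" for c
      using that t(2) by (auto simp: gap_def)
    have convX: "class_convex X r \<rho>" by (rule gap_order_class_convex[OF r t(2) \<rho>])
    have convY: "class_convex Y s fst"
      by (rule gap_order_class_convex[OF s t(2)]) (use e_le in auto)
    have "gap_order ?L X d0 r"
      unfolding gap_order_def
    proof (intro conjI allI impI)
      fix c x y z assume c: "gap ?L c" and X: "x \<in> X" "y \<in> X" "z \<in> X" "(x, z) \<in> r" "(z, y) \<in> r"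
        and le: "d0 x y \<le> c"
      show "d0 x z \<le> c"
      proof (cases "c < t")
        case True
        then show ?thesis using r'(3)[OF gapL[OF c True] X] le
          by (auto simp: d0_def min_le_iff_disj)
      qed (simp add: d0_def)
    qed (use r' in auto)
    note emb2' = emb2[OF this]
    have "gap_order ?U (\<rho> ` X) d (r \<inter> \<rho> ` X \<times> \<rho> ` X)"
      unfolding gap_order_def
    proof (intro conjI allI impI)
      show "strict_linear_order_on (\<rho> ` X) (r \<inter> \<rho> ` X \<times> \<rho> ` X)"
      proof -
        have "r \<inter> \<rho> ` X \<times> \<rho> ` X = {(x, y). x \<in> \<rho> ` X \<and> y \<in> \<rho> ` X \<and> (x, y) \<in> r}" by auto
        then show ?thesis
          using strict_linear_order_on_pullback[of X r "\<lambda>x. x" "\<rho> ` X"] r'(2) \<open>\<rho> ` X \<subseteq> X\<close>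
          by simp
      qed
      fix c x y z assume c: "gap ?U c" and xyz: "x \<in> \<rho> ` X" "y \<in> \<rho> ` X" "z \<in> \<rho> ` X"
        and rr: "(x, z) \<in> r \<inter> \<rho> ` X \<times> \<rho> ` X" "(z, y) \<in> r \<inter> \<rho> ` X \<times> \<rho> ` X" and le: "d x y \<le> c"
      have "x \<noteq> y" using rr rD(1,2) by blast
      then have "gap S c" using gapU[OF c finite_metric_spaceD(3)[OF Q xyz(1,2)] le] by simp
      then show "d x z \<le> c" using r'(3)[of c x y z] xyz rr le \<open>\<rho> ` X \<subseteq> X\<close> by blast
    qed auto
    note emb1' = emb1[OF this]
    obtain x0 where "x0 \<in> X" using False by blast
    have "Y2 \<noteq> {}"
    proof
      assume "Y2 = {}"
      then have "gap_order ?L Y2 e2 {}"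
        by (simp add: gap_order_def strict_linear_order_on_def irrefl_def trans_def total_on_def)
      then obtain f where "ordered_isometric_embedding X d0 r Y2 e2 {} f" using emb2' by blast
      then show False using \<open>Y2 = {}\<close> \<open>x0 \<in> X\<close> by (auto simp: ordered_isometric_embedding_def)
    qed
    then obtain i0 where i0: "i0 \<in> Y2" by blast
    \<comment> \<open>The columns are convex, so the induced order of the columns is independent of the height \<open>i0\<close>.\<close>
    let ?s1 = "{(u, v). u \<in> Y1 \<and> v \<in> Y1 \<and> ((u, i0), (v, i0)) \<in> s}"
    have s1: "gap_order ?U Y1 e1 ?s1"
      unfolding gap_order_def
    proof (intro conjI allI impI)
      show "strict_linear_order_on Y1 ?s1"
        by (rule strict_linear_order_on_pullback[OF s'(2)]) (use i0 in \<open>auto simp: inj_on_def Y_def\<close>)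
      fix c u v x assume c: "gap ?U c" and uvx: "u \<in> Y1" "v \<in> Y1" "x \<in> Y1"
        and ss: "(u, x) \<in> ?s1" "(x, v) \<in> ?s1" and le: "e1 u v \<le> c"
      have neq: "u \<noteq> v" "u \<noteq> x" using ss sD(1) sD(2)[of "(u, i0)" "(x, i0)" "(v, i0)"] by auto
      then have "gap S c" using gapU[OF c e1U[OF uvx(1,2)] le] by simp
      then show "e1 u x \<le> c"
        using s'(3)[of c "(u, i0)" "(v, i0)" "(x, i0)"] uvx ss le i0 neq by (simp add: e_def Y_def)
    qed auto
    obtain f1 where f1: "ordered_isometric_embedding (\<rho> ` X) d (r \<inter> \<rho> ` X \<times> \<rho> ` X) Y1 e1 ?s1 f1"
      using emb1'[OF s1] by blast
    let ?s2 = "\<lambda>u. {(i, j). i \<in> Y2 \<and> j \<in> Y2 \<and> ((u, i), (u, j)) \<in> s}"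
    have s2: "gap_order ?L Y2 e2 (?s2 u)" if u: "u \<in> Y1" for u
      unfolding gap_order_def
    proof (intro conjI allI impI)
      show "strict_linear_order_on Y2 (?s2 u)"
        by (rule strict_linear_order_on_pullback[OF s'(2)]) (use u in \<open>auto simp: inj_on_def Y_def\<close>)
      fix c i j l assume c: "gap ?L c" and ijl: "i \<in> Y2" "j \<in> Y2" "l \<in> Y2"
        and ss: "(i, l) \<in> ?s2 u" "(l, j) \<in> ?s2 u" and le: "e2 i j \<le> c"
      show "e2 i l \<le> c"
      proof (cases "c < t")
        case True
        then show ?thesis
          using s'(3)[OF gapL[OF c True], of "(u, i)" "(u, j)" "(u, l)"] u ijl ss le by (simp add: e_def Y_def)
      next
        case False
        then show ?thesis using e2t[OF ijl(1,3)] by simp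
      qed
    qed auto
    define f2 where "f2 = (\<lambda>u. SOME g. ordered_isometric_embedding X d0 r Y2 e2 (?s2 u) g)"
    have f2: "ordered_isometric_embedding X d0 r Y2 e2 (?s2 u) (f2 u)" if "u \<in> Y1" for u
      unfolding f2_def by (rule someI_ex[OF emb2'[OF s2[OF that]]])
    have f1_Y: "f1 p \<in> Y1" if "p \<in> \<rho> ` X" for p
      using f1 that by (auto simp: ordered_isometric_embedding_def)
    have f1_iso: "e1 (f1 p) (f1 q) = d p q" if "p \<in> \<rho> ` X" "q \<in> \<rho> ` X" for p q
      using f1 that by (auto simp: ordered_isometric_embedding_def)
    have f1_mono: "((f1 p, i0), (f1 q, i0)) \<in> s" if "p \<in> \<rho> ` X" "q \<in> \<rho> ` X" "(p, q) \<in> r" for p q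
      using f1 that by (auto simp: ordered_isometric_embedding_def)
    have f2_Y: "f2 u x \<in> Y2" if "u \<in> Y1" "x \<in> X" for u x
      using f2[OF that(1)] that(2) by (auto simp: ordered_isometric_embedding_def)
    have f2_iso: "e2 (f2 u x) (f2 u y) = d0 x y" if "u \<in> Y1" "x \<in> X" "y \<in> X" for u x y
      using f2[OF that(1)] that(2,3) by (auto simp: ordered_isometric_embedding_def)
    have f2_mono: "((u, f2 u x), (u, f2 u y)) \<in> s" if "u \<in> Y1" "x \<in> X" "y \<in> X" "(x, y) \<in> r" for u x y
      using f2[OF that(1)] that(2-4) unfolding ordered_isometric_embedding_def by simp
    define f where "f = (\<lambda>x. (f1 (\<rho> x), f2 (f1 (\<rho> x)) x))"
    have f1Y: "f1 (\<rho> x) \<in> Y1" if "x \<in> X" for x by (rule f1_Y) (use that in simp)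
    have fY: "f ` X \<subseteq> Y" using f1Y f2_Y by (auto simp: f_def Y_def)
    have iso: "e (f x) (f y) = d x y" if xy: "x \<in> X" "y \<in> X" for x y
    proof (cases "\<rho> x = \<rho> y")
      case True
      then have "e (f x) (f y) = d0 x y" using f2_iso[OF f1Y[OF xy(1)] xy] by (simp add: f_def e_def)
      then show ?thesis using True \<rho>[OF xy] by (simp add: d0_def)
    next
      case False
      have eq: "e1 (f1 (\<rho> x)) (f1 (\<rho> y)) = d (\<rho> x) (\<rho> y)" by (rule f1_iso) (use xy in simp_all)
      then have "f1 (\<rho> x) \<noteq> f1 (\<rho> y)"
        using False X.zero[OF \<rho>X[OF xy(1)] \<rho>X[OF xy(2)]] f1Y[OF xy(1)] by auto
      then show ?thesis using eq d\<rho>[OF xy] \<rho>[OF xy] False by (simp add: f_def e_def)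
    qed
    have "(f x, f y) \<in> s" if xy: "x \<in> X" "y \<in> X" "(x, y) \<in> r" for x y
    proof (rule order_preserving_by_classes[OF r'(2) convX s'(2) convY fY _ _ _ xy, where g = f1])
      fix p q assume "p \<in> \<rho> ` X" "q \<in> \<rho> ` X" and pq: "(p, q) \<in> quotient_order X r \<rho>"
      then have P: "p \<in> X" "q \<in> X" "\<rho> p = p" "\<rho> q = q" using \<rho>X \<rho>\<rho> by auto
      then have "(p, q) \<in> r" "p \<noteq> q" using quotient_order_iff[OF r'(2) convX P(1,2)] pq by auto
      then have ss: "((f1 p, i0), (f1 q, i0)) \<in> s"
        using f1_mono \<open>p \<in> \<rho> ` X\<close> \<open>q \<in> \<rho> ` X\<close> by blast
      moreover have "f1 p \<noteq> f1 q" using ss sD(1) by auto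
      moreover have "f1 p \<in> Y1" "f1 q \<in> Y1" using f1_Y \<open>p \<in> \<rho> ` X\<close> \<open>q \<in> \<rho> ` X\<close> by blast+
      ultimately show "(f1 p, f1 q) \<in> quotient_order Y s fst"
        using quotient_order_iff[OF s'(2) convY, of "(f1 p, i0)" "(f1 q, i0)"] i0 by (auto simp: Y_def)
    next
      fix x y assume X: "x \<in> X" "y \<in> X" "\<rho> x = \<rho> y" "(x, y) \<in> r"
      then have "((f1 (\<rho> x), f2 (f1 (\<rho> x)) x), (f1 (\<rho> x), f2 (f1 (\<rho> x)) y)) \<in> s"
        using f2_mono[OF f1Y[OF X(1)]] by blast
      then show "(f x, f y) \<in> s" using X(3) by (simp add: f_def)
    qed (simp add: f_def)
    then have "ordered_isometric_embedding X d r Y e s f"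
      using fY iso by (simp add: ordered_isometric_embedding_def)
    then show ?thesis by blast
  qed
  ultimately show ?thesis by (rule has_ordering_witnessI)
qed


section \<open>At most three distances\<close>

text \<open>Either all triangles are allowed, or the space is ultrametric. The case \<open>a = b\<close> covers a single
  distance.\<close>

lemma has_ordering_witness_upto_two_distances:
  fixes X :: "'a set"
  assumes X: "finite_metric_space {a, b} X d" and ab: "0 < a" "a \<le> b"
  shows "has_ordering_witness {a, b} X d"
proof (cases "b \<le> 2 * a")
  case True
  show ?thesis
    by (rule has_ordering_witness_filler[OF X, of a]) (use ab True in auto)
next
  case False
  have L: "{s \<in> {a, b}. s \<le> a} = {a}" and U: "{s \<in> {a, b}. a < s} = {b}" using ab False by auto
  show ?thesis
  proof (rule has_ordering_witness_lexicographic[OF X, of a, unfolded L U])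
    show "gap {a, b} a" using ab False by (auto simp: gap_def)
    show "has_ordering_witness {a} X e" if "finite_metric_space {a} X e" for e
      by (rule has_ordering_witness_filler[OF that, of a]) (use ab in auto)
    show "has_ordering_witness {b} Q d" if "finite_metric_space {b} Q d" for Q
      by (rule has_ordering_witness_filler[OF that, of b]) (use ab in auto)
  qed (use ab in auto)
qed

text \<open>If \<open>b \<le> 2 * a\<close> and \<open>c \<le> a + b\<close>, the only triangle that may be forbidden is \<open>a, a, c\<close>, and \<open>b\<close> is a
  filler. If \<open>b > 2 * a\<close> and \<open>c \<le> a + b\<close>, the classes modulo \<open>a\<close> restrict each other in no way. Otherwise
  \<open>c\<close> is too large for a triangle with \<open>a\<close> and \<open>b\<close>: this makes \<open>a\<close> or \<open>b\<close> a threshold for a lexicographic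
  product, unless \<open>b \<le> 2 * a\<close> and \<open>c \<le> 2 * b\<close>, which is excluded by the \<open>4\<close>-values condition.\<close>

lemma has_ordering_witness_three_distances:
  fixes X :: "'a set"
  assumes X: "finite_metric_space {a, b, c} X d" and abc: "0 < a" "a < b" "b < c"
    and four: "four_values {a, b, c}"
  shows "has_ordering_witness {a, b, c} X d"
proof (cases "b \<le> 2 * a")
  case small: True
  consider "c \<le> a + b" | "a + b < c" "c \<le> 2 * b" | "2 * b < c" by linarith
  then show ?thesis
  proof cases
    case 1
    show ?thesis
      by (rule has_ordering_witness_filler[OF X, of b]) (use abc small 1 in auto)
  next
    case 2
    \<comment> \<open>The triangles \<open>a, a, b\<close> and \<open>c, b, b\<close> cannot be amalgamated over the side \<open>b\<close>: the distance between
      their apices would be at least \<open>c - a > b\<close> and at most \<open>a + b < c\<close>.\<close>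
    have "\<exists>t\<in>{a, b, c}. \<bar>a - a\<bar> \<le> t \<and> t \<le> a + a \<and> \<bar>c - b\<bar> \<le> t \<and> t \<le> c + b"
      using abc small 2 by (intro bexI[of _ b]) auto
    then have "\<exists>u\<in>{a, b, c}. \<bar>a - c\<bar> \<le> u \<and> u \<le> a + c \<and> \<bar>a - b\<bar> \<le> u \<and> u \<le> a + b"
      using four unfolding four_values_def by blast
    then show ?thesis using abc 2 by auto
  next
    case 3
    have L: "{s \<in> {a, b, c}. s \<le> b} = {a, b}" and U: "{s \<in> {a, b, c}. b < s} = {c}" using abc by auto
    show ?thesis
    proof (rule has_ordering_witness_lexicographic[OF X, of b, unfolded L U])
      show "gap {a, b, c} b" using abc 3 by (auto simp: gap_def)
      show "has_ordering_witness {a, b} X e" if "finite_metric_space {a, b} X e" for e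
        by (rule has_ordering_witness_upto_two_distances[OF that]) (use abc in auto)
      show "has_ordering_witness {c} Q d" if "finite_metric_space {c} Q d" for Q
        by (rule has_ordering_witness_filler[OF that, of c]) (use abc in auto)
    qed (use abc in auto)
  qed
next
  case large: False
  have gap: "gap {a, b, c} a" using abc large by (auto simp: gap_def)
  show ?thesis
  proof (cases "c \<le> a + b")
    case True
    show ?thesis
      by (rule has_ordering_witness_equidistant_classes[OF X _ _ _ gap, of b]) (use abc large True in auto)
  next
    case False
    have L: "{s \<in> {a, b, c}. s \<le> a} = {a}" and U: "{s \<in> {a, b, c}. a < s} = {b, c}" using abc by auto
    show ?thesis
    proof (rule has_ordering_witness_lexicographic[OF X _ _ gap, unfolded L U])
      show "has_ordering_witness {a} X e" if "finite_metric_space {a} X e" for e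
        by (rule has_ordering_witness_filler[OF that, of a]) (use abc in auto)
      show "has_ordering_witness {b, c} Q d" if "finite_metric_space {b, c} Q d" for Q
        by (rule has_ordering_witness_upto_two_distances[OF that]) (use abc in auto)
    qed (use abc False in auto)
  qed
qed

lemma has_ordering_witness_card_le_3:
  fixes X :: "'a set"
  assumes S: "finite S" "S \<subseteq> {0<..}" "card S \<le> 3" "four_values S"
    and X: "finite_metric_space S X d"
  shows "has_ordering_witness S X d"
proof -
  define l where "l = sorted_list_of_set S"
  have l: "set l = S" "length l = card S" "sorted l" "distinct l"
    using S(1) by (simp_all add: l_def)
  then have "length l \<le> 3" using S(3) by simp
  then consider "l = []" | a where "l = [a]" | a b where "l = [a, b]" | a b c where "l = [a, b, c]"
    by (cases l rule: list.exhaust; cases "tl l"; cases "tl (tl l)"; cases "tl (tl (tl l))") auto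
  then show ?thesis
  proof cases
    case 1
    then have "S = {}" using l(1) by simp
    then show ?thesis
      using finite_metric_spaceD(2,3)[OF X] by (intro has_ordering_witness_subsingleton) auto
  next
    case (2 a)
    then have "S = {a, a}" "0 < a" using l(1) S(2) by auto
    then show ?thesis using has_ordering_witness_upto_two_distances[of a a X d] X by simp
  next
    case (3 a b)
    then have "S = {a, b}" "0 < a" "a \<le> b" using l S(2) by auto
    then show ?thesis using has_ordering_witness_upto_two_distances[of a b X d] X by simp
  next
    case (4 a b c)
    then have "S = {a, b, c}" "0 < a" "a < b" "b < c" using l S(2) by auto
    then show ?thesis using has_ordering_witness_three_distances[of a b c X d] X S(4) by simp
  qed
qed

theorem theorem21:
  fixes S :: "real set" and X :: "'a set" and dX :: "'a \<Rightarrow> 'a \<Rightarrow> real"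
  assumes "finite S" and "S \<subseteq> {0<..}" and "card S \<le> 3" and "four_values S"
    and "finite_metric_space S X dX"
  shows "\<exists>(Y :: nat set) dY. finite_metric_space S Y dY \<and>
           (\<forall>rX rY. metric_linear_order S X dX rX \<and> metric_linear_order S Y dY rY \<longrightarrow>
              (\<exists>f. ordered_isometric_embedding X dX rX Y dY rY f))"
proof -
  obtain Y :: "nat set" and dY where Y: "finite_metric_space S Y dY"
    and emb: "\<And>r s. gap_order S X dX r \<Longrightarrow> gap_order S Y dY s \<Longrightarrow>
      \<exists>f. ordered_isometric_embedding X dX r Y dY s f"
    using has_ordering_witness_card_le_3[OF assms] unfolding has_ordering_witness_def by blast
  have "\<exists>f. ordered_isometric_embedding X dX rX Y dY rY f"
    if "metric_linear_order S X dX rX" "metric_linear_order S Y dY rY" for rX rY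
    using that by (intro emb metric_linear_order_imp_gap_order assms(5) Y)
  then show ?thesis using Y by blast
qed

end
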